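(* Let $U$ be a universal prefix-free machine, and let $S$ be an infinite $\Delta^0_2$ subset of $M_U=\{\rho : U(\rho)\downarrow \text{ and } |\rho| = K(U(\rho))\}$. Then $\emptyset'\le_T S$.
   Context: $K$ denotes prefix-free Kolmogorov complexity defined from $U$. $M_U$ is the set of minimal-length $U$-descriptions. *)

theory Defs
  imports Main "HOL-Library.Nat_Bijection" "HOL-Library.Extended_Nat" "HOL-Library.Sublist"
begin

section \<open>Partial recursive functions relative to a set\<close>

text \<open>
  Kleene's schemes for partial recursive functions, presented for unary functions on \<^typ>\<open>nat\<close>:
  several arguments are passed through the pairing bijection \<^const>\<open>prod_encode\<close>.
  \<open>Query\<close> evaluates the characteristic function of the set \<open>A\<close> being consulted.
\<close>

datatype prog =
    Zero | Succ | Fst | Snd | Query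
  | Tup prog prog | Comp prog prog | PrimRec prog prog | Mu prog

text \<open>
  \<open>Mu p\<close> is unbounded search: it diverges unless there is an \<open>n\<close> with \<open>p(x, n) = 0\<close>
  such that all earlier values \<open>p(x, m)\<close> converge (to nonzero numbers).
\<close>

primrec run :: "nat set \<Rightarrow> prog \<Rightarrow> nat \<rightharpoonup> nat" where
  "run A Zero = (\<lambda>x. Some 0)"
| "run A Succ = (\<lambda>x. Some (Suc x))"
| "run A Fst = (\<lambda>x. Some (fst (prod_decode x)))"
| "run A Snd = (\<lambda>x. Some (snd (prod_decode x)))"
| "run A Query = (\<lambda>x. Some (of_bool (x \<in> A)))"
| "run A (Tup p q) = (\<lambda>x. Option.bind (run A p x)
     (\<lambda>u. Option.bind (run A q x) (\<lambda>v. Some (prod_encode (u, v)))))"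
| "run A (Comp p q) = (\<lambda>x. Option.bind (run A q x) (run A p))"
| "run A (PrimRec p q) = (\<lambda>x. let (a, n) = prod_decode x in
     rec_nat (run A p a)
       (\<lambda>m r. Option.bind r (\<lambda>v. run A q (prod_encode (a, prod_encode (m, v))))) n)"
| "run A (Mu p) = (\<lambda>x.
     let zero_at = (\<lambda>n. run A p (prod_encode (x, n)) = Some 0
           \<and> (\<forall>m<n. run A p (prod_encode (x, m)) \<noteq> None))
     in if \<exists>n. zero_at n then Some (LEAST n. zero_at n) else None)"

primrec prog_code :: "prog \<Rightarrow> nat" where
  "prog_code Zero = 0"
| "prog_code Succ = 1"
| "prog_code Fst = 2"
| "prog_code Snd = 3"
| "prog_code Query = 4"
| "prog_code (Tup p q) = 5 + 4 * prod_encode (prog_code p, prog_code q)"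
| "prog_code (Comp p q) = 6 + 4 * prod_encode (prog_code p, prog_code q)"
| "prog_code (PrimRec p q) = 7 + 4 * prod_encode (prog_code p, prog_code q)"
| "prog_code (Mu p) = 8 + 4 * prog_code p"

lemma prog_code_inj: "prog_code p = prog_code q \<Longrightarrow> p = q"
proof (induction p arbitrary: q)
  case (Tup a b) then show ?case by (cases q) (auto, presburger+)
next case (Comp a b) then show ?case by (cases q) (auto, presburger+)
next case (PrimRec a b) then show ?case by (cases q) (auto, presburger+)
next case (Mu a) then show ?case by (cases q) (auto, presburger+)
qed (case_tac q; simp)+


section \<open>Turing reducibility, jump, arithmetical classes\<close>

definition turing_le :: "nat set \<Rightarrow> nat set \<Rightarrow> bool" (infix "\<le>\<^sub>T" 50) where
  "A \<le>\<^sub>T B \<longleftrightarrow> (\<exists>p. \<forall>x. run B p x = Some (of_bool (x \<in> A)))"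

definition computable_set :: "nat set \<Rightarrow> bool" where
  "computable_set A \<longleftrightarrow> (\<exists>p. \<forall>x. run {} p x = Some (of_bool (x \<in> A)))"

definition jump :: "nat set \<Rightarrow> nat set" where
  "jump A = {prog_code p | p. run A p (prog_code p) \<noteq> None}"

definition Sigma02 :: "nat set \<Rightarrow> bool" where
  "Sigma02 A \<longleftrightarrow> (\<exists>R. computable_set R \<and>
     (\<forall>x. x \<in> A \<longleftrightarrow> (\<exists>y. \<forall>z. prod_encode (x, prod_encode (y, z)) \<in> R)))"

definition Pi02 :: "nat set \<Rightarrow> bool" where
  "Pi02 A \<longleftrightarrow> (\<exists>R. computable_set R \<and>
     (\<forall>x. x \<in> A \<longleftrightarrow> (\<forall>y. \<exists>z. prod_encode (x, prod_encode (y, z)) \<in> R)))"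

definition Delta02 :: "nat set \<Rightarrow> bool" where
  "Delta02 A \<longleftrightarrow> Sigma02 A \<and> Pi02 A"


section \<open>Prefix-free machines and complexity\<close>

text \<open>
  Binary strings are identified with natural numbers by the following bijection
  (bijective base-2 numeration, least significant digit first).
\<close>

primrec str_code :: "bool list \<Rightarrow> nat" where
  "str_code [] = 0"
| "str_code (b # \<sigma>) = 2 * str_code \<sigma> + (if b then 2 else 1)"

lemma bij_str_code: "bij str_code"
proof -
  have i: "str_code a = str_code b \<Longrightarrow> a = b" for a b
  proof (induction a arbitrary: b)
    case Nil then show ?case by (cases b) (auto split: if_splits)
  next
    case (Cons x xs) show ?case
    proof (cases b)
      case Nil then show ?thesis using Cons by (auto split: if_splits)
    next
      case (Cons y ys) 
      with Cons.prems have "x = y \<and> str_code xs = str_code ys" by (simp split: if_splits) presburger+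
      then show ?thesis using Cons.IH Cons by auto
    qed
  qed
  have "\<exists>a. n = str_code a" for n
  proof (induction n rule: less_induct)
    case (less n)
    show ?case
    proof (cases "n = 0")
      case True then show ?thesis by (metis str_code.simps(1))
    next
      case False
      then have "(n - 1) div 2 < n" by presburger
      then obtain a where a: "(n - 1) div 2 = str_code a" using less by blast
      have "n = str_code (even n # a)" using a False by (simp, presburger)
      then show ?thesis by blast
    qed
  qed
  then show ?thesis using i by (auto simp: bij_def inj_on_def surj_def)
qed

definition partial_computable :: "(bool list \<rightharpoonup> bool list) \<Rightarrow> bool" where
  "partial_computable M \<longleftrightarrow>
     (\<exists>p. \<forall>\<sigma>. run {} p (str_code \<sigma>) = map_option str_code (M \<sigma>))"

definition prefix_free_machine :: "(bool list \<rightharpoonup> bool list) \<Rightarrow> bool" where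
  "prefix_free_machine M \<longleftrightarrow> partial_computable M \<and>
     (\<forall>\<sigma>\<in>dom M. \<forall>\<tau>\<in>dom M. prefix \<sigma> \<tau> \<longrightarrow> \<sigma> = \<tau>)"

text \<open>The infimum is \<open>\<infinity>\<close> when \<open>x\<close> has no \<open>M\<close>-description.\<close>

definition K :: "(bool list \<rightharpoonup> bool list) \<Rightarrow> bool list \<Rightarrow> enat" where
  "K M x = (INF \<sigma>\<in>{\<sigma>. M \<sigma> = Some x}. enat (length \<sigma>))"

text \<open>
  Universality is taken in the sense of the invariance theorem (also called optimality).
  It is implied by universality by adjunction, that is, by the existence for each
  prefix-free \<open>M\<close> of a string \<open>\<rho>\<close> with \<open>U(\<rho>\<sigma>) = M(\<sigma>)\<close> for all \<open>\<sigma>\<close>.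
\<close>

definition universal_prefix_free_machine :: "(bool list \<rightharpoonup> bool list) \<Rightarrow> bool" where
  "universal_prefix_free_machine U \<longleftrightarrow> prefix_free_machine U \<and>
     (\<forall>M. prefix_free_machine M \<longrightarrow> (\<exists>c::nat. \<forall>x. K U x \<le> K M x + enat c))"

definition minimal_descriptions :: "(bool list \<rightharpoonup> bool list) \<Rightarrow> bool list set" where
  "minimal_descriptions U = {\<rho> \<in> dom U. enat (length \<rho>) = K U (the (U \<rho>))}"

end

theory Submission
  imports Defs
begin

text \<open>
  Fix a computable approximation \<open>S\<^sub>s\<close> of \<open>S\<close> that converges pointwise. For every \<open>n\<close> the strings of
  length at least \<open>3 n\<close> are coloured one after the other with \<open>8\<^sup>n\<close> colours: at stage \<open>s\<close>, if some
  colour does not occur on \<open>S\<^sub>s\<close>, the next uncoloured string receives the least such colour. Since \<open>S\<close> is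
  infinite, in the end every colour occurs on \<open>S\<close>.

  When \<open>n\<close> enters the halting problem at stage \<open>s\<close>, the Kraft inequality yields a colour whose members in
  the domain of \<open>U\<close> seen by stage \<open>s\<close> have total weight at most \<open>8\<^sup>-\<^sup>n\<close>. A prefix-free machine can
  therefore describe \<open>U \<sigma>\<close>, for all these \<open>\<sigma>\<close>, by strings of length \<open>\<bar>\<sigma>\<bar> - 2 n + 1\<close>. If \<open>n\<close> is large, none
  of these \<open>\<sigma>\<close> is a minimal description. Hence, once a computation with oracle \<open>S\<close> has found a stage \<open>t\<close> by which
  every colour occurs on a member of \<open>S\<close> seen in the domain of \<open>U\<close>, it knows that \<open>n\<close> does not enter the halting problem after stage \<open>t\<close>.
\<close>

section \<open>Computable functions and decidable predicates\<close>

abbreviation pfst :: "nat \<Rightarrow> nat" where "pfst x \<equiv> fst (prod_decode x)"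
abbreviation psnd :: "nat \<Rightarrow> nat" where "psnd x \<equiv> snd (prod_decode x)"

definition computable :: "nat set \<Rightarrow> (nat \<Rightarrow> nat) \<Rightarrow> bool" where
  "computable A f \<longleftrightarrow> (\<exists>p. \<forall>x. run A p x = Some (f x))"

definition decidable :: "nat set \<Rightarrow> (nat \<Rightarrow> bool) \<Rightarrow> bool" where
  "decidable A P \<longleftrightarrow> computable A (\<lambda>x. of_bool (P x))"

text \<open>Answering each query with 0 simulates the empty oracle, so what is computable without an
  oracle stays computable with any oracle.\<close>

primrec query_free :: "prog \<Rightarrow> prog" where
  "query_free Zero = Zero"
| "query_free Succ = Succ"
| "query_free Fst = Fst"
| "query_free Snd = Snd"
| "query_free Query = Zero"
| "query_free (Tup p q) = Tup (query_free p) (query_free q)"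
| "query_free (Comp p q) = Comp (query_free p) (query_free q)"
| "query_free (PrimRec p q) = PrimRec (query_free p) (query_free q)"
| "query_free (Mu p) = Mu (query_free p)"

lemma run_query_free: "run A (query_free p) = run {} p"
  by (induction p) auto

lemma computable_any_oracle: "computable {} f \<Longrightarrow> computable A f"
  unfolding computable_def by (metis run_query_free)

lemma computable_compose:
  assumes "computable A f" "computable A g" shows "computable A (\<lambda>x. f (g x))"
proof -
  obtain p q where "\<And>x. run A p x = Some (f x)" "\<And>x. run A q x = Some (g x)"
    using assms unfolding computable_def by blast
  then have "run A (Comp p q) x = Some (f (g x))" for x by simp
  then show ?thesis unfolding computable_def by blast
qed

lemma computable_id: "computable A (\<lambda>x. x)"
proof -
  have "run A (Tup Fst Snd) x = Some x" for x by simp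
  then show ?thesis unfolding computable_def by blast
qed

lemma computable_Suc: assumes "computable A f" shows "computable A (\<lambda>x. Suc (f x))"
proof -
  have "computable A Suc" unfolding computable_def by (rule exI[of _ Succ]) simp
  from computable_compose[OF this assms] show ?thesis .
qed

lemma computable_const: "computable A (\<lambda>x. c)"
proof (induction c)
  case 0 show ?case unfolding computable_def by (rule exI[of _ Zero]) simp
qed (rule computable_Suc)

lemma computable_pfst: assumes "computable A f" shows "computable A (\<lambda>x. pfst (f x))"
proof -
  have "computable A pfst" unfolding computable_def by (rule exI[of _ Fst]) simp
  from computable_compose[OF this assms] show ?thesis .
qed

lemma computable_psnd: assumes "computable A f" shows "computable A (\<lambda>x. psnd (f x))"
proof -
  have "computable A psnd" unfolding computable_def by (rule exI[of _ Snd]) simp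
  from computable_compose[OF this assms] show ?thesis .
qed

lemma decidable_oracle: assumes "computable A f" shows "decidable A (\<lambda>x. f x \<in> A)"
proof -
  have "computable A (\<lambda>x. of_bool (x \<in> A))" unfolding computable_def by (rule exI[of _ Query]) simp
  from computable_compose[OF this assms] show ?thesis unfolding decidable_def .
qed

lemma computable_pair: assumes "computable A f" "computable A g" shows "computable A (\<lambda>x. prod_encode (f x, g x))"
proof -
  obtain p q where "\<And>x. run A p x = Some (f x)" "\<And>x. run A q x = Some (g x)"
    using assms unfolding computable_def by blast
  then have "run A (Tup p q) x = Some (prod_encode (f x, g x))" for x by simp
  then show ?thesis unfolding computable_def by blast
qed

text \<open>The schemes are unary, so a binary \<open>h\<close> is shown computable on pairs; this
  rule then substitutes arbitrary computable arguments.\<close>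

lemma computable_apply2:
  assumes "computable A (\<lambda>z. h (pfst z) (psnd z))" "computable A f" "computable A g"
  shows "computable A (\<lambda>x. h (f x) (g x))"
  using computable_compose[OF assms(1) computable_pair[OF assms(2,3)]] by simp

lemma computable_apply3:
  assumes "computable A (\<lambda>z. h (pfst z) (pfst (psnd z)) (psnd (psnd z)))" "computable A f" "computable A g" "computable A e"
  shows "computable A (\<lambda>x. h (f x) (g x) (e x))"
  using computable_compose[OF assms(1) computable_pair[OF assms(2) computable_pair[OF assms(3,4)]]] by simp

lemma computable_rec_nat:
  assumes "computable A a" "computable A (\<lambda>z. g (pfst z) (pfst (psnd z)) (psnd (psnd z)))" "computable A n"
  shows "computable A (\<lambda>x. rec_nat (a x) (g x) (n x))"
proof -
  obtain p q where p: "\<And>x. run A p x = Some (a x)"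
    and q: "\<And>x. run A q x = Some (g (pfst x) (pfst (psnd x)) (psnd (psnd x)))"
    using assms(1,2) unfolding computable_def by blast
  have rec: "rec_nat (run A p y) (\<lambda>m r. Option.bind r (\<lambda>v. run A q (prod_encode (y, prod_encode (m, v))))) k
      = Some (rec_nat (a y) (g y) k)" for y k
    by (induction k) (simp_all add: p q)
  have "run A (PrimRec p q) x = Some (rec_nat (a (pfst x)) (g (pfst x)) (psnd x))" for x
    using rec by (simp add: case_prod_beta)
  then have "computable A (\<lambda>z. rec_nat (a (pfst z)) (g (pfst z)) (psnd z))"
    unfolding computable_def by blast
  from computable_apply2[OF this computable_id assms(3)] show ?thesis .
qed

section \<open>Arithmetic functions\<close>

lemma computable_add: assumes "computable A f" "computable A g" shows "computable A (\<lambda>x. f x + g x)"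
proof -
  have "computable A (\<lambda>x. rec_nat (f x) (\<lambda>m r. Suc r) (g x))"
    by (intro computable_rec_nat computable_Suc computable_psnd computable_id assms)
  moreover have "rec_nat a (\<lambda>m. Suc) b = a + b" for a b by (induction b) auto
  ultimately show ?thesis by simp
qed

lemma computable_mult: assumes "computable A f" "computable A g" shows "computable A (\<lambda>x. f x * g x)"
proof -
  have "computable A (\<lambda>z. rec_nat 0 (\<lambda>m r. r + pfst z) (psnd z))"
    by (intro computable_rec_nat computable_add computable_psnd computable_pfst computable_id computable_const)
  moreover have "rec_nat 0 (\<lambda>m r. r + a) b = a * b" for a b :: nat by (induction b) auto
  ultimately show ?thesis using computable_apply2[of A "(*)", OF _ assms] by simp
qed

lemma computable_power: assumes "computable A f" "computable A g" shows "computable A (\<lambda>x. f x ^ g x)"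
proof -
  have "computable A (\<lambda>z. rec_nat 1 (\<lambda>m r. pfst z * r) (psnd z))"
    by (intro computable_rec_nat computable_mult computable_psnd computable_pfst computable_id computable_const)
  moreover have "rec_nat 1 (\<lambda>m r. a * r) b = a ^ b" for a b :: nat by (induction b) auto
  ultimately show ?thesis using computable_apply2[of A "(^)", OF _ assms] by simp
qed

lemma computable_diff: assumes "computable A f" "computable A g" shows "computable A (\<lambda>x. f x - g x)"
proof -
  \<comment> \<open>The predecessor: the recursion step returns the counter and ignores the previous
    value.\<close>
  have "computable A (\<lambda>x. rec_nat 0 (\<lambda>m r. m) x)"
    by (intro computable_rec_nat computable_psnd computable_pfst computable_id computable_const)
  moreover have "rec_nat 0 (\<lambda>m r. m) b = b - 1" for b :: nat by (cases b) auto
  ultimately have "computable A (\<lambda>x. x - 1)" by simp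
  note pred = computable_compose[OF this]
  have "computable A (\<lambda>z. rec_nat (f z) (\<lambda>m r. r - 1) (g z))"
    by (intro computable_rec_nat pred computable_psnd computable_id assms)
  moreover have "rec_nat a (\<lambda>m r. r - 1) b = a - b" for a b :: nat by (induction b) auto
  ultimately show ?thesis by simp
qed

section \<open>Decidable predicates and bounded quantifiers\<close>

lemma decidable_eq_0: assumes "computable A f" shows "decidable A (\<lambda>x. f x = 0)"
proof -
  have "computable A (\<lambda>x. 1 - f x)" by (intro computable_diff computable_const assms)
  moreover have "1 - f x = of_bool (f x = 0)" for x by simp
  ultimately show ?thesis unfolding decidable_def by simp
qed

lemma decidable_not: assumes "decidable A P" shows "decidable A (\<lambda>x. \<not> P x)"
proof -
  have "(of_bool (P x) = (0::nat)) = (\<not> P x)" for x by simp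
  then show ?thesis using decidable_eq_0[OF assms[unfolded decidable_def]] by simp
qed

lemma decidable_conj: assumes "decidable A P" "decidable A Q" shows "decidable A (\<lambda>x. P x \<and> Q x)"
  using computable_mult[OF assms[unfolded decidable_def]] unfolding decidable_def by (simp add: of_bool_conj)

lemma decidable_disj: assumes "decidable A P" "decidable A Q" shows "decidable A (\<lambda>x. P x \<or> Q x)"
  using decidable_not[OF decidable_conj[OF decidable_not[OF assms(1)] decidable_not[OF assms(2)]]] by simp

lemma decidable_imp: assumes "decidable A P" "decidable A Q" shows "decidable A (\<lambda>x. P x \<longrightarrow> Q x)"
  using decidable_disj[OF decidable_not[OF assms(1)] assms(2)] by (simp only: imp_conv_disj)

lemma decidable_le: assumes "computable A f" "computable A g" shows "decidable A (\<lambda>x. f x \<le> g x)"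
  using decidable_eq_0[OF computable_diff[OF assms]] by simp

lemma decidable_less: assumes "computable A f" "computable A g" shows "decidable A (\<lambda>x. f x < g x)"
  using decidable_le[OF computable_Suc[OF assms(1)] assms(2)] by (simp add: Suc_le_eq)

lemma decidable_eq: assumes "computable A f" "computable A g" shows "decidable A (\<lambda>x. f x = g x)"
  using decidable_conj[OF decidable_le[OF assms] decidable_le[OF assms(2,1)]] by (simp add: order_eq_iff)

lemma decidable_const: "decidable A (\<lambda>x. b)"
  unfolding decidable_def by (rule computable_const)

lemma decidable_finite: assumes "finite F" "computable A f" shows "decidable A (\<lambda>x. f x \<in> F)"
  using assms(1)
proof induction
  case empty show ?case by (simp add: decidable_const)
next
  case (insert a F)
  then show ?case using decidable_disj[OF decidable_eq[OF assms(2) computable_const]] by simp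
qed

lemma computable_if: assumes "decidable A P" "computable A f" "computable A g" shows "computable A (\<lambda>x. if P x then f x else g x)"
proof -
  have "computable A (\<lambda>x. of_bool (P x) * f x + of_bool (\<not> P x) * g x)"
    using decidable_not[OF assms(1)] by (intro computable_add computable_mult assms(2,3) assms(1)[unfolded decidable_def]) (simp add: decidable_def)
  moreover have "of_bool (P x) * f x + of_bool (\<not> P x) * g x = (if P x then f x else g x)" for x by simp
  ultimately show ?thesis by simp
qed

lemma decidable_if: assumes "decidable A P" "decidable A Q" "decidable A R" shows "decidable A (\<lambda>x. if P x then Q x else R x)"
  using computable_if[OF assms(1) assms(2)[unfolded decidable_def] assms(3)[unfolded decidable_def]]
  unfolding decidable_def by (simp add: if_distrib)

lemma computable_sum:
  assumes "computable A (\<lambda>z. f (pfst z) (psnd z))" "computable A b"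
  shows "computable A (\<lambda>x. \<Sum>i<b x. f x i)"
proof -
  have "computable A (\<lambda>z. f (pfst z) (pfst (psnd z)))"
    by (intro computable_apply2[OF assms(1)] computable_pfst computable_psnd computable_id)
  then have "computable A (\<lambda>x. rec_nat 0 (\<lambda>m r. r + f x m) (b x))"
    by (intro computable_rec_nat computable_add computable_psnd computable_id computable_const assms(2))
  moreover have "rec_nat 0 (\<lambda>m r. r + f x m) n = (\<Sum>i<n. f x i)" for n x by (induction n) auto
  ultimately show ?thesis by simp
qed

lemma decidable_ex_less:
  assumes "decidable A (\<lambda>z. P (pfst z) (psnd z))" "computable A b"
  shows "decidable A (\<lambda>x. \<exists>i<b x. P x i)"
proof -
  \<comment> \<open>A bounded existential quantifier holds iff the sum of its truth values is
    nonzero.\<close>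
  have "decidable A (\<lambda>x. \<not> (\<Sum>i<b x. of_bool (P x i)) = (0::nat))"
    by (intro decidable_not decidable_eq_0 computable_sum assms assms(1)[unfolded decidable_def])
  moreover have "(\<not> (\<Sum>i<b x. of_bool (P x i)) = (0::nat)) = (\<exists>i<b x. P x i)" for x by auto
  ultimately show ?thesis by simp
qed

lemma decidable_all_less:
  assumes "decidable A (\<lambda>z. P (pfst z) (psnd z))" "computable A b"
  shows "decidable A (\<lambda>x. \<forall>i<b x. P x i)"
  using decidable_not[OF decidable_ex_less[OF decidable_not[OF assms(1)] assms(2)]] by simp

lemma decidable_ex_le:
  assumes "decidable A (\<lambda>z. P (pfst z) (psnd z))" "computable A b"
  shows "decidable A (\<lambda>x. \<exists>i\<le>b x. P x i)"
  using decidable_ex_less[OF assms(1) computable_Suc[OF assms(2)]] by (simp add: less_Suc_eq_le)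

lemma decidable_all_le:
  assumes "decidable A (\<lambda>z. P (pfst z) (psnd z))" "computable A b"
  shows "decidable A (\<lambda>x. \<forall>i\<le>b x. P x i)"
  using decidable_all_less[OF assms(1) computable_Suc[OF assms(2)]] by (simp add: less_Suc_eq_le)

section \<open>Unbounded search\<close>

lemma run_Mu:
  assumes "\<And>z. run A p z = Some (of_bool (\<not> P (pfst z) (psnd z)))"
  shows "run A (Mu p) x = (if \<exists>n. P x n then Some (LEAST n. P x n) else None)"
  \<comment> \<open>Since \<open>p\<close> is total, the convergence condition in the scheme for
    \<open>Mu\<close> always holds and only the least zero matters.\<close>
  by (simp add: assms Let_def)

lemma computable_Least:
  assumes "decidable A (\<lambda>z. P (pfst z) (psnd z))" "\<And>x. \<exists>n. P x n"
  shows "computable A (\<lambda>x. LEAST n. P x n)"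
proof -
  obtain p where p: "\<And>z. run A p z = Some (of_bool (\<not> P (pfst z) (psnd z)))"
    using decidable_not[OF assms(1)] unfolding decidable_def computable_def by blast
  have "run A (Mu p) x = Some (LEAST n. P x n)" for x
    using run_Mu[of A p P, OF p] assms(2) by simp
  then show ?thesis unfolding computable_def by blast
qed

text \<open>The search diverges exactly when there is no witness; this is how the partial function
  \<open>compressor\<close> is computed.\<close>

lemma partial_search:
  assumes "decidable A (\<lambda>z. P (pfst z) (psnd z))" "computable A f"
  shows "\<exists>p. \<forall>x. run A p x = (if \<exists>n. P x n then Some (f (LEAST n. P x n)) else None)"
proof -
  obtain p where p: "\<And>z. run A p z = Some (of_bool (\<not> P (pfst z) (psnd z)))"
    using decidable_not[OF assms(1)] unfolding decidable_def computable_def by blast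
  obtain q where q: "\<And>z. run A q z = Some (f z)"
    using assms(2) unfolding computable_def by blast
  have "run A (Comp q (Mu p)) x = (if \<exists>n. P x n then Some (f (LEAST n. P x n)) else None)" for x
    using run_Mu[of A p P, OF p] q by simp
  then show ?thesis by blast
qed

lemma computable_div: assumes "computable A f" "computable A g" shows "computable A (\<lambda>x. f x div g x)"
proof -
  \<comment> \<open>The disjunct \<open>psnd z = 0\<close> stops the search at 0, the value of
    \<open>div\<close> for divisor 0.\<close>
  have "computable A (\<lambda>z. LEAST q. psnd z = 0 \<or> pfst z < psnd z * Suc q)" (is "computable A (\<lambda>z. LEAST q. ?P z q)")
  proof (rule computable_Least)
    show "decidable A (\<lambda>z. ?P (pfst z) (psnd z))"
      by (intro decidable_disj decidable_eq decidable_less computable_mult computable_Suc computable_psnd computable_pfst computable_id computable_const)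
    fix z show "\<exists>q. ?P z q"
      by (rule exI[of _ "pfst z"]) (cases "psnd z"; simp)
  qed
  moreover have "(LEAST q. b = 0 \<or> a < b * Suc q) = a div b" for a b :: nat
  proof (cases "b = 0")
    case False
    show ?thesis
    proof (rule Least_equality)
      show "b = 0 \<or> a < b * Suc (a div b)" using False dividend_less_times_div[of b a] by simp
      fix q assume "b = 0 \<or> a < b * Suc q"
      then have "a div b < Suc q" using False by (simp add: less_mult_imp_div_less mult.commute)
      then show "a div b \<le> q" by simp
    qed
  qed simp
  ultimately show ?thesis using computable_apply2[of A "(div)", OF _ assms] by simp
qed

lemma computable_mod: assumes "computable A f" "computable A g" shows "computable A (\<lambda>x. f x mod g x)"
  using computable_diff[OF assms(1) computable_mult[OF computable_div[OF assms] assms(2)]]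
  by (simp add: minus_div_mult_eq_mod)

lemmas computable_intros = computable_id computable_const computable_Suc computable_pfst computable_psnd computable_pair computable_add computable_mult computable_power
  computable_diff computable_div computable_mod computable_if computable_sum
  decidable_not decidable_conj decidable_disj decidable_imp decidable_le decidable_less decidable_eq decidable_const decidable_if
  decidable_ex_less decidable_all_less decidable_ex_le decidable_all_le

section \<open>Computation certificates\<close>

definition eval_item :: "nat \<Rightarrow> nat \<Rightarrow> nat \<Rightarrow> nat" where
  "eval_item e x y = prod_encode (e, prod_encode (x, y))"

text \<open>
  \<open>justified X e x y\<close> says that the claim ``program \<open>e\<close> maps \<open>x\<close> to \<open>y\<close>'' follows in one step from the
  claims in \<open>X\<close>; the residue of \<open>e - 5\<close> modulo 4 is the outermost constructor of \<open>e\<close>. A set closed under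
  justification can be trusted although its members are not ordered, because every step passes to
  a subprogram or decreases the argument of a primitive recursion.
\<close>

definition justified :: "nat set \<Rightarrow> nat \<Rightarrow> nat \<Rightarrow> nat \<Rightarrow> bool" where
  "justified X e x y \<longleftrightarrow>
    (if e = 0 then y = 0 else if e = 1 then y = Suc x
     else if e = 2 then y = pfst x else if e = 3 then y = psnd x
     else if e = 4 then y = 0
     else if (e - 5) mod 4 = 0 then
       eval_item (pfst ((e - 5) div 4)) x (pfst y) \<in> X \<and> eval_item (psnd ((e - 5) div 4)) x (psnd y) \<in> X
     else if (e - 5) mod 4 = 1 then
       (\<exists>u. eval_item (psnd ((e - 5) div 4)) x u \<in> X \<and> eval_item (pfst ((e - 5) div 4)) u y \<in> X)
     else if (e - 5) mod 4 = 2 then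
       (if psnd x = 0 then eval_item (pfst ((e - 5) div 4)) (pfst x) y \<in> X
        else \<exists>v. eval_item e (prod_encode (pfst x, psnd x - 1)) v \<in> X \<and>
          eval_item (psnd ((e - 5) div 4)) (prod_encode (pfst x, prod_encode (psnd x - 1, v))) y \<in> X)
     else eval_item ((e - 5) div 4) (prod_encode (x, y)) 0 \<in> X \<and>
       (\<forall>m<y. \<exists>v. v \<noteq> 0 \<and> eval_item ((e - 5) div 4) (prod_encode (x, m)) v \<in> X))"

definition supported :: "nat set \<Rightarrow> bool" where
  "supported X \<longleftrightarrow> (\<forall>e x y. eval_item e x y \<in> X \<longrightarrow> justified X e x y)"

lemma code_arith: "r < 4 \<Longrightarrow> (5 + (r + 4 * q) - 5) mod 4 = r \<and> (5 + (r + 4 * q) - 5) div 4 = q" for r q :: nat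
  by simp

lemma justified_Tup: "justified X (prog_code (Tup p q)) x y \<longleftrightarrow>
    eval_item (prog_code p) x (pfst y) \<in> X \<and> eval_item (prog_code q) x (psnd y) \<in> X"
proof -
  define e where "e = prog_code (Tup p q)"
  have "e = 5 + (0 + 4 * prod_encode (prog_code p, prog_code q))" unfolding e_def by simp
  then have "e > 4" "(e - 5) mod 4 = 0" "(e - 5) div 4 = prod_encode (prog_code p, prog_code q)"
    using code_arith[of 0 "prod_encode (prog_code p, prog_code q)"] by simp_all
  then show ?thesis unfolding e_def[symmetric] by (simp add: justified_def)
qed

lemma justified_Comp: "justified X (prog_code (Comp p q)) x y \<longleftrightarrow>
    (\<exists>u. eval_item (prog_code q) x u \<in> X \<and> eval_item (prog_code p) u y \<in> X)"
proof -
  define e where "e = prog_code (Comp p q)"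
  have "e = 5 + (1 + 4 * prod_encode (prog_code p, prog_code q))" unfolding e_def by simp
  then have "e > 4" "(e - 5) mod 4 = 1" "(e - 5) div 4 = prod_encode (prog_code p, prog_code q)"
    using code_arith[of 1 "prod_encode (prog_code p, prog_code q)"] by simp_all
  then show ?thesis unfolding e_def[symmetric] by (simp add: justified_def)
qed

lemma justified_PrimRec: "justified X (prog_code (PrimRec p q)) x y \<longleftrightarrow>
    (if psnd x = 0 then eval_item (prog_code p) (pfst x) y \<in> X
     else \<exists>v. eval_item (prog_code (PrimRec p q)) (prod_encode (pfst x, psnd x - 1)) v \<in> X \<and>
       eval_item (prog_code q) (prod_encode (pfst x, prod_encode (psnd x - 1, v))) y \<in> X)"
proof -
  define e where "e = prog_code (PrimRec p q)"
  have "e = 5 + (2 + 4 * prod_encode (prog_code p, prog_code q))" unfolding e_def by simp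
  then have "e > 4" "(e - 5) mod 4 = 2" "(e - 5) div 4 = prod_encode (prog_code p, prog_code q)"
    using code_arith[of 2 "prod_encode (prog_code p, prog_code q)"] by simp_all
  then show ?thesis unfolding e_def[symmetric] by (simp add: justified_def)
qed

lemma justified_Mu: "justified X (prog_code (Mu p)) x y \<longleftrightarrow>
    eval_item (prog_code p) (prod_encode (x, y)) 0 \<in> X \<and>
    (\<forall>m<y. \<exists>v. v \<noteq> 0 \<and> eval_item (prog_code p) (prod_encode (x, m)) v \<in> X)"
proof -
  define e where "e = prog_code (Mu p)"
  have "e = 5 + (3 + 4 * prog_code p)" unfolding e_def by simp
  then have "e > 4" "(e - 5) mod 4 = 3" "(e - 5) div 4 = prog_code p"
    using code_arith[of 3 "prog_code p"] by simp_all
  then show ?thesis unfolding e_def[symmetric] by (simp add: justified_def)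
qed

text \<open>\<open>X\<close> occurs only positively, so a justification survives enlarging
  \<open>X\<close>; certificates can therefore be merged by union.\<close>

lemma justified_mono: "justified X e x y \<Longrightarrow> X \<subseteq> Y \<Longrightarrow> justified Y e x y"
  unfolding justified_def by (smt (verit) subsetD)

lemma supported_Un: "supported X \<Longrightarrow> supported Y \<Longrightarrow> supported (X \<union> Y)"
  unfolding supported_def by (meson Un_iff Un_upper1 Un_upper2 justified_mono)

lemma supported_UN: "(\<And>i. i \<in> I \<Longrightarrow> supported (X i)) \<Longrightarrow> supported (\<Union>i\<in>I. X i)"
  unfolding supported_def by (meson UN_iff UN_upper justified_mono)

lemma eval_item_inject [simp]: "eval_item e x y = eval_item e' x' y' \<longleftrightarrow> e = e' \<and> x = x' \<and> y = y'"
  by (auto simp: eval_item_def)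

lemma supported_insert: "supported X \<Longrightarrow> justified X e x y \<Longrightarrow> supported (insert (eval_item e x y) X)"
  unfolding supported_def by (metis insertE insertI1 eval_item_inject justified_mono subset_insertI)

lemma supported_sound:
  assumes "supported X" "eval_item (prog_code p) x y \<in> X"
  shows "run {} p x = Some y"
  using assms(2)
proof (induction p arbitrary: x y)
  case (Tup p q)
  have "justified X (prog_code (Tup p q)) x y" using assms(1) Tup.prems unfolding supported_def by blast
  then have "run {} p x = Some (pfst y)" "run {} q x = Some (psnd y)" using Tup.IH by (simp_all only: justified_Tup)
  then show ?case by simp
next
  case (Comp p q)
  have "justified X (prog_code (Comp p q)) x y" using assms(1) Comp.prems unfolding supported_def by blast
  then obtain u where "run {} q x = Some u" "run {} p u = Some y"
    using Comp.IH by (auto simp only: justified_Comp)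
  then show ?case by simp
next
  case (PrimRec p q)
  define P where "P = PrimRec p q"
  \<comment> \<open>A recursion step refers to the same program, so the induction over subprograms
    is supplemented by one on the recursion argument \<open>n\<close>.\<close>
  have "eval_item (prog_code P) (prod_encode (a, n)) y \<in> X \<Longrightarrow> run {} P (prod_encode (a, n)) = Some y" for a n y
  proof (induction n arbitrary: y)
    case 0
    then have "justified X (prog_code P) (prod_encode (a, 0)) y" using assms(1) unfolding supported_def by blast
    then show ?case using PrimRec.IH by (simp only: P_def justified_PrimRec) simp
  next
    case (Suc n)
    then have "justified X (prog_code P) (prod_encode (a, Suc n)) y" using assms(1) unfolding supported_def by blast
    then obtain v where v: "eval_item (prog_code P) (prod_encode (a, n)) v \<in> X"
      "eval_item (prog_code q) (prod_encode (a, prod_encode (n, v))) y \<in> X"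
      by (simp only: P_def justified_PrimRec) auto
    from Suc.IH[OF v(1)] PrimRec.IH(2)[OF v(2)] show ?case by (simp add: P_def)
  qed
  from this[of "pfst x" "psnd x"] PrimRec.prems show ?case by (simp add: P_def)
next
  case (Mu p)
  have "justified X (prog_code (Mu p)) x y" using assms(1) Mu.prems unfolding supported_def by blast
  then have j: "eval_item (prog_code p) (prod_encode (x, y)) 0 \<in> X"
    "\<forall>m<y. \<exists>v. v \<noteq> 0 \<and> eval_item (prog_code p) (prod_encode (x, m)) v \<in> X" unfolding justified_Mu by blast+
  define Z where "Z n \<longleftrightarrow> run {} p (prod_encode (x, n)) = Some 0 \<and>
    (\<forall>m<n. run {} p (prod_encode (x, m)) \<noteq> None)" for n
  have run: "run {} (Mu p) x = (if \<exists>n. Z n then Some (LEAST n. Z n) else None)"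
    unfolding Z_def by (simp add: Let_def)
  have less: "m < y \<Longrightarrow> \<exists>v. v \<noteq> 0 \<and> run {} p (prod_encode (x, m)) = Some v" for m using j(2) Mu.IH by blast
  then have "Z y" using Mu.IH[OF j(1)] unfolding Z_def by fastforce
  moreover have "(LEAST n. Z n) = y"
  proof (rule Least_equality)
    fix n assume "Z n"
    then show "y \<le> n" using less[of n] unfolding Z_def by (auto simp: not_less[symmetric])
  qed fact
  ultimately show ?case unfolding run by auto
next
  case Zero
  then show ?case using assms(1) unfolding supported_def justified_def by fastforce
next
  case Succ
  then show ?case using assms(1) unfolding supported_def justified_def by fastforce
next
  case Fst
  then have "justified X 2 x y" using assms(1) unfolding supported_def by fastforce
  then show ?case by (simp add: justified_def)
next
  case Snd
  then have "justified X 3 x y" using assms(1) unfolding supported_def by fastforce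
  then show ?case by (simp add: justified_def)
next
  case Query
  then have "justified X 4 x y" using assms(1) unfolding supported_def by fastforce
  then show ?case by (simp add: justified_def)
qed

definition evaluates :: "nat \<Rightarrow> nat \<Rightarrow> nat \<Rightarrow> bool" where
  "evaluates e x y \<longleftrightarrow> (\<exists>X. finite X \<and> supported X \<and> eval_item e x y \<in> X)"

lemma evaluatesI:
  assumes "finite X" "supported X" "justified X e x y" shows "evaluates e x y"
  unfolding evaluates_def
  by (rule exI[of _ "insert (eval_item e x y) X"]) (simp add: assms supported_insert)

text \<open>The finite certificates of the subcomputations are merged and one item is added; for
  \<open>Mu\<close> there is one certificate for each argument up to the zero found.\<close>

lemma evaluates_complete: "run {} p x = Some y \<Longrightarrow> evaluates (prog_code p) x y"
proof (induction p arbitrary: x y)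
  case (Tup p q)
  then obtain u v where "run {} p x = Some u" "run {} q x = Some v" and y: "y = prod_encode (u, v)"
    by (auto split: bind_splits)
  with Tup.IH obtain X Y where "finite X" "supported X" "eval_item (prog_code p) x u \<in> X"
    "finite Y" "supported Y" "eval_item (prog_code q) x v \<in> Y" unfolding evaluates_def by meson
  then show ?case using y
    by (intro evaluatesI[of "X \<union> Y"] supported_Un) (simp_all only: justified_Tup, auto)
next
  case (Comp p q)
  then obtain u where "run {} q x = Some u" "run {} p u = Some y"
    by (auto split: bind_splits)
  with Comp.IH obtain X Y where "finite X" "supported X" "eval_item (prog_code q) x u \<in> X"
    "finite Y" "supported Y" "eval_item (prog_code p) u y \<in> Y" unfolding evaluates_def by meson
  then show ?case
    by (intro evaluatesI[of "X \<union> Y"] supported_Un) (simp_all only: justified_Comp, auto)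
next
  case (PrimRec p q)
  define P where "P = PrimRec p q"
  have "run {} P (prod_encode (a, n)) = Some y \<Longrightarrow> evaluates (prog_code P) (prod_encode (a, n)) y" for a n y
  proof (induction n arbitrary: y)
    case 0
    then have "run {} p a = Some y" by (simp add: P_def)
    with PrimRec.IH obtain X where "finite X" "supported X" "eval_item (prog_code p) a y \<in> X"
      unfolding evaluates_def by meson
    then show ?case unfolding P_def
      by (intro evaluatesI[of X]) (simp_all only: justified_PrimRec, auto)
  next
    case (Suc n)
    then obtain v where "run {} P (prod_encode (a, n)) = Some v"
      "run {} q (prod_encode (a, prod_encode (n, v))) = Some y"
      unfolding P_def by (auto simp: case_prod_beta split: bind_splits)
    with Suc.IH PrimRec.IH(2) obtain X Y where "finite X" "supported X"
      "eval_item (prog_code P) (prod_encode (a, n)) v \<in> X"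
      "finite Y" "supported Y" "eval_item (prog_code q) (prod_encode (a, prod_encode (n, v))) y \<in> Y"
      unfolding evaluates_def by meson
    then show ?case unfolding P_def
      by (intro evaluatesI[of "X \<union> Y"] supported_Un) (simp_all only: justified_PrimRec, auto)
  qed
  from this[of "pfst x" "psnd x"] PrimRec.prems show ?case by (simp add: P_def)
next
  case (Mu p)
  define Z where "Z n \<longleftrightarrow> run {} p (prod_encode (x, n)) = Some 0 \<and>
    (\<forall>m<n. run {} p (prod_encode (x, m)) \<noteq> None)" for n
  have run: "run {} (Mu p) x = (if \<exists>n. Z n then Some (LEAST n. Z n) else None)"
    unfolding Z_def by (simp add: Let_def)
  have ex: "\<exists>n. Z n" and y: "y = (LEAST n. Z n)"
    using Mu.prems unfolding run by (auto split: if_splits)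
  from LeastI_ex[OF ex] have Zy: "Z y" by (simp add: y)
  have nZ: "m < y \<Longrightarrow> \<not> Z m" for m using not_less_Least y by blast
  have "\<exists>v. v \<noteq> 0 \<and> run {} p (prod_encode (x, m)) = Some v" if m: "m < y" for m
  proof -
    obtain v where v: "run {} p (prod_encode (x, m)) = Some v" using Zy m unfolding Z_def by blast
    have "\<forall>m'<m. run {} p (prod_encode (x, m')) \<noteq> None" using Zy m unfolding Z_def by auto
    then have "v \<noteq> 0" using v nZ[OF m] unfolding Z_def by auto
    then show ?thesis using v by blast
  qed
  with Mu.IH have "\<exists>X v. v \<noteq> 0 \<and> finite X \<and> supported X \<and> eval_item (prog_code p) (prod_encode (x, m)) v \<in> X" if "m < y" for m
    using that unfolding evaluates_def by meson
  then obtain X v where X: "\<And>m. m < y \<Longrightarrow> v m \<noteq> 0" "\<And>m. m < y \<Longrightarrow> finite (X m)" "\<And>m. m < y \<Longrightarrow> supported (X m)"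
    "\<And>m. m < y \<Longrightarrow> eval_item (prog_code p) (prod_encode (x, m)) (v m) \<in> X m" by metis
  obtain Y where Y: "finite Y" "supported Y" "eval_item (prog_code p) (prod_encode (x, y)) 0 \<in> Y"
    using Mu.IH Zy unfolding Z_def evaluates_def by meson
  show ?case
  proof (rule evaluatesI[of "Y \<union> (\<Union>m\<in>{..<y}. X m)"])
    show "supported (Y \<union> (\<Union>m\<in>{..<y}. X m))" using X Y by (intro supported_Un supported_UN) auto
    show "justified (Y \<union> (\<Union>m\<in>{..<y}. X m)) (prog_code (Mu p)) x y"
      using X(1,4) Y(3) by (simp only: justified_Mu) blast
  qed (use X Y in auto)
qed (auto intro!: evaluatesI[of "{}"] simp: supported_def justified_def)

lemma evaluates_iff: "evaluates (prog_code p) x y \<longleftrightarrow> run {} p x = Some y"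
proof
  assume "evaluates (prog_code p) x y"
  then show "run {} p x = Some y" unfolding evaluates_def using supported_sound by blast
qed (rule evaluates_complete)

section \<open>Program numbers, numerical certificates and the halting problem\<close>

lemma surj_prog_code: "\<exists>p. prog_code p = e"
proof (induction e rule: less_induct)
  case (less e)
  show ?case
  proof (cases "e < 5")
    case True
    then have "e \<in> {0, 1, 2, 3, 4}" by auto
    then show ?thesis using prog_code.simps(1-5) by blast
  next
    case False
    define q r where "q = (e - 5) div 4" and "r = (e - 5) mod 4"
    have e: "e = 5 + r + 4 * q" and r: "r < 4" using False unfolding q_def r_def by auto
    have q: "q < e" using e by linarith
    then have "pfst q < e" "psnd q < e"
      using le_prod_encode_1[of "pfst q" "psnd q"] le_prod_encode_2[of "psnd q" "pfst q"] by simp_all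
    with less q obtain p1 p2 p where "prog_code p1 = pfst q" "prog_code p2 = psnd q" "prog_code p = q" by metis
    then have "prog_code (Tup p1 p2) = 5 + 4 * q" "prog_code (Comp p1 p2) = 6 + 4 * q"
      "prog_code (PrimRec p1 p2) = 7 + 4 * q" "prog_code (Mu p) = 8 + 4 * q"
      by (simp_all only: prog_code.simps prod.collapse prod_decode_inverse)
    moreover have "e \<in> {5 + 4 * q, 6 + 4 * q, 7 + 4 * q, 8 + 4 * q}" using e r by auto
    ultimately show ?thesis by (metis insertE singletonD)
  qed
qed

text \<open>A number \<open>D\<close> serves as a certificate through the finite set of its binary digits.\<close>

definition certifies :: "nat \<Rightarrow> nat \<Rightarrow> nat \<Rightarrow> nat \<Rightarrow> bool" where
  "certifies D e x y \<longleftrightarrow> supported (set_decode D) \<and> eval_item e x y \<in> set_decode D"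

lemma ex_certifies: "(\<exists>D. certifies D e x y) \<longleftrightarrow> evaluates e x y"
  unfolding certifies_def evaluates_def by (metis finite_set_decode set_encode_inverse)

text \<open>With the bounds on the components of a pair, this confines everything a certificate
  mentions below the certificate itself, so that quantifiers become bounded.\<close>

lemma set_decode_less: "t \<in> set_decode D \<Longrightarrow> t < D"
proof -
  assume "t \<in> set_decode D"
  then have "odd (D div 2 ^ t)" by (simp add: set_decode_def)
  then have "2 ^ t \<le> D" by (metis div_less even_zero not_less)
  then show ?thesis by (meson less_exp less_le_trans)
qed

lemma eval_item_less:
  assumes "eval_item e x y \<in> set_decode D" shows "e < D" "x < D" "y < D"
proof -
  have "eval_item e x y < D" by (rule set_decode_less[OF assms])
  moreover have "e \<le> eval_item e x y" "x \<le> eval_item e x y" "y \<le> eval_item e x y"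
    unfolding eval_item_def
    by (rule le_prod_encode_1)
      (meson le_prod_encode_1 le_prod_encode_2 order_trans)+
  ultimately show "e < D" "x < D" "y < D" by auto
qed

lemma decidable_set_decode: assumes "computable A f" "computable A g" shows "decidable A (\<lambda>x. f x \<in> set_decode (g x))"
proof -
  have "decidable A (\<lambda>x. (g x div 2 ^ f x) mod 2 = 1)" by (intro computable_intros assms)
  then show ?thesis by (simp add: set_decode_def odd_iff_mod_2_eq_one)
qed

lemma computable_eval_item:
  "computable A f \<Longrightarrow> computable A g \<Longrightarrow> computable A h \<Longrightarrow> computable A (\<lambda>x. eval_item (f x) (g x) (h x))"
  unfolding eval_item_def by (intro computable_intros)

lemma ex_bounded: "(\<And>u. P u \<Longrightarrow> u < (b::nat)) \<Longrightarrow> (\<exists>u. P u) = (\<exists>u<b. P u)" by blast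

lemma decidable_supported: assumes "computable A f" shows "decidable A (\<lambda>x. supported (set_decode (f x)))"
proof -
  \<comment> \<open>\<open>J\<close> is \<open>justified\<close> for the digits of \<open>D\<close>
    with its existential quantifiers bounded by \<open>D\<close>, hence decidable.\<close>
  define J where "J D e x y \<longleftrightarrow>
    (if e = 0 then y = 0 else if e = 1 then y = Suc x
     else if e = 2 then y = pfst x else if e = 3 then y = psnd x
     else if e = 4 then y = 0
     else if (e - 5) mod 4 = 0 then
       eval_item (pfst ((e - 5) div 4)) x (pfst y) \<in> set_decode D \<and> eval_item (psnd ((e - 5) div 4)) x (psnd y) \<in> set_decode D
     else if (e - 5) mod 4 = 1 then
       (\<exists>u<D. eval_item (psnd ((e - 5) div 4)) x u \<in> set_decode D \<and> eval_item (pfst ((e - 5) div 4)) u y \<in> set_decode D)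
     else if (e - 5) mod 4 = 2 then
       (if psnd x = 0 then eval_item (pfst ((e - 5) div 4)) (pfst x) y \<in> set_decode D
        else \<exists>v<D. eval_item e (prod_encode (pfst x, psnd x - 1)) v \<in> set_decode D \<and>
          eval_item (psnd ((e - 5) div 4)) (prod_encode (pfst x, prod_encode (psnd x - 1, v))) y \<in> set_decode D)
     else eval_item ((e - 5) div 4) (prod_encode (x, y)) 0 \<in> set_decode D \<and>
       (\<forall>m<y. \<exists>v<D. v \<noteq> 0 \<and> eval_item ((e - 5) div 4) (prod_encode (x, m)) v \<in> set_decode D))" for D e x y
  have J: "justified (set_decode D) e x y \<longleftrightarrow> J D e x y" for D e x y
  proof -
    have *: "(\<exists>u. eval_item a x u \<in> set_decode D \<and> eval_item b u y \<in> set_decode D)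
      = (\<exists>u<D. eval_item a x u \<in> set_decode D \<and> eval_item b u y \<in> set_decode D)"
      "(\<exists>v. eval_item e z v \<in> set_decode D \<and> eval_item b (w v) y \<in> set_decode D)
      = (\<exists>v<D. eval_item e z v \<in> set_decode D \<and> eval_item b (w v) y \<in> set_decode D)"
      "(\<exists>v. v \<noteq> 0 \<and> eval_item a z v \<in> set_decode D) = (\<exists>v<D. v \<noteq> 0 \<and> eval_item a z v \<in> set_decode D)" for a b z w
      by (rule ex_bounded; use eval_item_less in blast)+
    show ?thesis unfolding justified_def J_def * ..
  qed
  have "supported (set_decode D) \<longleftrightarrow>
      (\<forall>t<D. t \<in> set_decode D \<longrightarrow> J D (pfst t) (pfst (psnd t)) (psnd (psnd t)))" for D
  proof -
    have "supported (set_decode D) \<longleftrightarrow>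
      (\<forall>t. t \<in> set_decode D \<longrightarrow> J D (pfst t) (pfst (psnd t)) (psnd (psnd t)))"
      unfolding supported_def J eval_item_def by (metis fst_conv prod.collapse prod_decode_inverse prod_encode_inverse snd_conv)
    then show ?thesis using set_decode_less by blast
  qed
  moreover have "decidable A (\<lambda>D. \<forall>t<D. t \<in> set_decode D \<longrightarrow> J D (pfst t) (pfst (psnd t)) (psnd (psnd t)))"
    unfolding J_def by (intro computable_intros decidable_set_decode computable_eval_item)
  ultimately have "decidable A (\<lambda>D. supported (set_decode D))" by simp
  from computable_compose[OF this[unfolded decidable_def] assms] show ?thesis unfolding decidable_def .
qed

lemma decidable_certifies:
  "computable A f \<Longrightarrow> computable A g \<Longrightarrow> computable A h \<Longrightarrow> computable A i \<Longrightarrow> decidable A (\<lambda>x. certifies (f x) (g x) (h x) (i x))"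
  unfolding certifies_def by (intro computable_intros decidable_supported decidable_set_decode computable_eval_item)

lemma certifies_less: "certifies D e x y \<Longrightarrow> e < D \<and> x < D \<and> y < D"
  unfolding certifies_def using eval_item_less by blast

text \<open>\<open>D\<close> is itself the certificate and not a time bound, so this is not monotone
  in \<open>D\<close>.\<close>

definition halts_by :: "nat \<Rightarrow> nat \<Rightarrow> bool" where
  "halts_by n D \<longleftrightarrow> (\<exists>y<D. certifies D n n y)"

lemma decidable_halts_by: assumes "computable A f" "computable A g" shows "decidable A (\<lambda>x. halts_by (f x) (g x))"
  unfolding halts_by_def
  by (intro decidable_certifies computable_compose[OF assms(1)] computable_compose[OF assms(2)] computable_intros)

lemma jump_iff_halts_by: "n \<in> jump {} \<longleftrightarrow> (\<exists>D. halts_by n D)"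
proof -
  \<comment> \<open>Every number is the code of a program, so no \<open>n\<close> falls outside the
    correspondence.\<close>
  obtain p where p: "prog_code p = n" using surj_prog_code by blast
  have "n \<in> jump {} \<longleftrightarrow> run {} p n \<noteq> None"
    unfolding jump_def using p by (auto dest: prog_code_inj)
  also have "\<dots> \<longleftrightarrow> (\<exists>y. evaluates n n y)"
    using evaluates_iff[of p n] by (simp add: p)
  also have "\<dots> \<longleftrightarrow> (\<exists>D. halts_by n D)"
    unfolding halts_by_def ex_certifies[symmetric] using certifies_less by blast
  finally show ?thesis .
qed

section \<open>Approximation in the limit\<close>

text \<open>One direction of Shoenfield's limit lemma.\<close>

lemma limit_approximation:
  assumes "Delta02 X"
  obtains g where "decidable {} (\<lambda>z. g (pfst z) (psnd z))" "\<And>x. \<exists>s0. \<forall>s\<ge>s0. g x s \<longleftrightarrow> x \<in> X"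
proof -
  obtain R Q where R: "computable_set R" and Q: "computable_set Q"
    and R_iff: "\<And>x. x \<in> X \<longleftrightarrow> (\<exists>y. \<forall>z. prod_encode (x, prod_encode (y, z)) \<in> R)"
    and Q_iff: "\<And>x. x \<in> X \<longleftrightarrow> (\<forall>y. \<exists>z. prod_encode (x, prod_encode (y, z)) \<in> Q)"
    using assms unfolding Delta02_def Sigma02_def Pi02_def by blast
  have compR: "computable {} (\<lambda>x. of_bool (x \<in> R))" "computable {} (\<lambda>x. of_bool (x \<in> Q))"
    using R Q unfolding computable_set_def computable_def by simp_all
  have decR: "decidable {} (\<lambda>x. f x \<in> R)" "decidable {} (\<lambda>x. f x \<in> Q)" if "computable {} f" for f
    using compR[THEN computable_compose, OF that] unfolding decidable_def by simp_all
  \<comment> \<open>The least witness for membership (with respect to \<open>R\<close>) or for non-membership (with respect to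
    \<open>Q\<close>) that looks good up to \<open>s\<close> decides.\<close>
  define g where "g x s \<longleftrightarrow> (\<exists>y\<le>s. (\<forall>z\<le>s. prod_encode (x, prod_encode (y, z)) \<in> R) \<and>
    (\<forall>y'<y. \<exists>z\<le>s. prod_encode (x, prod_encode (y', z)) \<in> Q))" for x s
  have "decidable {} (\<lambda>z. g (pfst z) (psnd z))"
    unfolding g_def by (intro computable_intros decR)
  moreover have "\<exists>s0. \<forall>s\<ge>s0. g x s \<longleftrightarrow> x \<in> X" for x
  proof (cases "x \<in> X")
    case True
    obtain y where y: "\<And>z. prod_encode (x, prod_encode (y, z)) \<in> R" using True R_iff by blast
    obtain z where z: "\<And>y'. prod_encode (x, prod_encode (y', z y')) \<in> Q" using True Q_iff by metis
    \<comment> \<open>From this stage on \<open>y\<close> is in the range of the search and the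
      \<open>Q\<close>-witnesses for all \<open>y' < y\<close> are found.\<close>
    have "g x s" if "s \<ge> y + (\<Sum>y'<y. z y')" for s
    proof -
      have "z y' \<le> s" if "y' < y" for y'
        using member_le_sum[of y' "{..<y}" z] that \<open>s \<ge> y + (\<Sum>y'<y. z y')\<close> by simp
      then show ?thesis unfolding g_def using y z that by (intro exI[of _ y]) auto
    qed
    with True show ?thesis by blast
  next
    case False
    obtain y where y: "\<And>z. prod_encode (x, prod_encode (y, z)) \<notin> Q" using False Q_iff by blast
    obtain z where z: "\<And>y'. prod_encode (x, prod_encode (y', z y')) \<notin> R" using False R_iff by metis
    \<comment> \<open>Past this stage each \<open>u \<le> y\<close> has a counterexample to
      \<open>R\<close> in range, while \<open>u > y\<close> would need a \<open>Q\<close>-witness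
      for \<open>y\<close>, which does not exist.\<close>
    have "\<not> g x s" if s: "s \<ge> (\<Sum>y'\<le>y. z y')" for s
    proof
      assume "g x s"
      then obtain u where u: "\<forall>z\<le>s. prod_encode (x, prod_encode (u, z)) \<in> R"
        "\<forall>y'<u. \<exists>z\<le>s. prod_encode (x, prod_encode (y', z)) \<in> Q" unfolding g_def by blast
      then have "u \<le> y" using y by (meson not_less)
      then have "z u \<le> s" using member_le_sum[of u "{..y}" z] s by simp
      then show False using u(1) z by blast
    qed
    with False show ?thesis by blast
  qed
  ultimately show ?thesis using that by blast
qed

section \<open>Colouring\<close>

text \<open>
  A colouring of \<open>0, \<dots>, m - 1\<close> with \<open>k\<close> colours is represented by the pair of \<open>m\<close> and a number \<open>L\<close>, the base
  \<open>k\<close> digits of which are the colours. The coloured number \<open>i\<close> stands for \<open>k + i\<close>, so that for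
  \<open>k = 8 ^ n\<close> only codes of strings of length at least \<open>3 * n\<close> receive a colour.
\<close>

definition colour :: "nat \<Rightarrow> nat \<Rightarrow> nat \<Rightarrow> nat" where
  "colour k L i = (L div k ^ i) mod k"

text \<open>The minimum is taken over all numbers and so always exists; a value of at least
  \<open>k\<close> signals that no colour is missed.\<close>

definition missed :: "(nat \<Rightarrow> nat \<Rightarrow> bool) \<Rightarrow> nat \<Rightarrow> nat \<Rightarrow> nat \<Rightarrow> nat" where
  "missed g k s st = (LEAST j. \<forall>i<pfst st. colour k (psnd st) i = j \<longrightarrow> \<not> g (k + i) s)"

definition painting :: "(nat \<Rightarrow> nat \<Rightarrow> bool) \<Rightarrow> nat \<Rightarrow> nat \<Rightarrow> nat" where
  "painting g k s = rec_nat (prod_encode (0, 0))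
    (\<lambda>s st. if missed g k s st < k
      then prod_encode (Suc (pfst st), psnd st + missed g k s st * k ^ pfst st) else st) s"

definition coloured :: "(nat \<Rightarrow> nat \<Rightarrow> bool) \<Rightarrow> nat \<Rightarrow> nat \<Rightarrow> nat \<Rightarrow> nat \<Rightarrow> bool" where
  "coloured g k s j a \<longleftrightarrow> k \<le> a \<and> a - k < pfst (painting g k s) \<and>
    colour k (psnd (painting g k s)) (a - k) = j"

lemma colour_less: "0 < k \<Longrightarrow> colour k L i < k"
  by (simp add: colour_def)

lemma missed_total: "\<exists>j. \<forall>i<m. colour k L i = j \<longrightarrow> \<not> g (k + i) s"
proof -
  obtain j where "j \<notin> colour k L ` {..<m}" by (meson ex_new_if_finite finite_imageI finite_lessThan infinite_UNIV_nat)
  then show ?thesis by (intro exI[of _ j]) auto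
qed

lemma missed_prop: "i < pfst st \<Longrightarrow> colour k (psnd st) i = missed g k s st \<Longrightarrow> \<not> g (k + i) s"
  using LeastI_ex[OF missed_total[where m = "pfst st" and k = k and L = "psnd st" and g = g and s = s]] unfolding missed_def by blast

lemma missed_ge:
  assumes "0 < k" "k \<le> missed g k s st" "j < k"
  shows "\<exists>i<pfst st. colour k (psnd st) i = j \<and> g (k + i) s"
proof -
  have "j < (LEAST j. \<forall>i<pfst st. colour k (psnd st) i = j \<longrightarrow> \<not> g (k + i) s)"
    using assms unfolding missed_def by simp
  from not_less_Least[OF this] show ?thesis by blast
qed

text \<open>The added number is a multiple of \<open>k ^ Suc i\<close>, so digit \<open>i\<close>
  does not notice it.\<close>

lemma colour_append_old:
  assumes "0 < k" "i < m" shows "colour k (L + j * k ^ m) i = colour k L i"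
proof -
  obtain d where m: "m = i + Suc d" using assms(2) less_imp_Suc_add by auto
  have eq: "L + j * k ^ m = L + (j * k ^ d * k) * k ^ i" by (simp add: m power_add)
  have "(L + j * k ^ m) div k ^ i = j * k ^ d * k + L div k ^ i"
    unfolding eq by (rule div_mult_self1) (use assms(1) in simp)
  then show ?thesis unfolding colour_def by simp
qed

lemma colour_append_new:
  assumes "L < k ^ m" "j < k" shows "colour k (L + j * k ^ m) m = j"
  using assms unfolding colour_def by simp

lemma painting_0 [simp]: "painting g k 0 = prod_encode (0, 0)"
  by (simp add: painting_def)

lemma painting_Suc: "painting g k (Suc s) = (let st = painting g k s in
    if missed g k s st < k
    then prod_encode (Suc (pfst st), psnd st + missed g k s st * k ^ pfst st) else st)"
  by (simp add: painting_def Let_def)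

text \<open>Digits from the length on are 0, so the next colour is written into an empty digit
  without carry.\<close>

lemma painting_bound: "0 < k \<Longrightarrow> psnd (painting g k s) < k ^ pfst (painting g k s)"
proof (induction s)
  case (Suc s)
  define st where "st = painting g k s"
  define j where "j = missed g k s st"
  have IH: "psnd st < k ^ pfst st" using Suc unfolding st_def by simp
  show ?case
  proof (cases "j < k")
    case True
    have "psnd st + j * k ^ pfst st < Suc j * k ^ pfst st" using IH by simp
    also have "\<dots> \<le> k * k ^ pfst st" using True by (intro mult_le_mono1) simp
    finally show ?thesis using True by (simp add: painting_Suc Let_def st_def j_def)
  qed (use IH in \<open>simp add: painting_Suc Let_def st_def j_def\<close>)
qed simp

lemma coloured_mono:
  assumes "0 < k" "s \<le> t" "coloured g k s j a" shows "coloured g k t j a"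
  using assms(2,3)
proof (induction rule: dec_induct)
  case (step t)
  then show ?case using colour_append_old[OF assms(1)]
    by (auto simp: coloured_def painting_Suc Let_def less_Suc_eq)
qed

lemma pfst_painting_mono: "s \<le> t \<Longrightarrow> pfst (painting g k s) \<le> pfst (painting g k t)"
proof (induction rule: dec_induct)
  case (step t)
  then show ?case by (auto simp: painting_Suc Let_def)
qed simp

lemma eventually_fixed:
  fixes g :: "nat \<Rightarrow> nat \<Rightarrow> bool"
  assumes "\<And>x. \<exists>s0. \<forall>s\<ge>s0. g x s \<longleftrightarrow> x \<in> X" "finite F"
  shows "\<exists>s0. \<forall>s\<ge>s0. \<forall>x\<in>F. g x s \<longleftrightarrow> x \<in> X"
  using assms(2)
proof induction
  case (insert x F)
  obtain s0 where "\<forall>s\<ge>s0. \<forall>x\<in>F. g x s \<longleftrightarrow> x \<in> X" using insert.IH by (rule exE)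
  moreover obtain s1 where "\<forall>s\<ge>s1. g x s \<longleftrightarrow> x \<in> X" using assms(1)[of x] by (rule exE)
  ultimately show ?case by (intro exI[of _ "s0 + s1"]) (metis insert_iff add_leE)
qed simp

text \<open>
  If \<open>J\<close> is the set of colours occurring on \<open>X\<close>, then from some stage on the approximation always
  sees all of them, so that numbers coloured later get colours outside \<open>J\<close>. Since nothing
  is coloured while no colour is missed, a proper subset \<open>J\<close> would leave \<open>X\<close> finite.
\<close>

lemma all_colours_hit:
  assumes lim: "\<And>x. \<exists>s0. \<forall>s\<ge>s0. g x s \<longleftrightarrow> x \<in> X" and inf: "infinite X" and j: "j < k"
  shows "\<exists>a\<in>X. \<exists>s. coloured g k s j a"
proof (rule ccontr)
  assume no_j: "\<not> ?thesis"
  have k: "0 < k" using j by simp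
  define m where "m s = pfst (painting g k s)" for s
  define J where "J = {i. i < k \<and> (\<exists>a\<in>X. \<exists>s. coloured g k s i a)}"
  have "\<forall>i\<in>J. \<exists>a s. a \<in> X \<and> coloured g k s i a" unfolding J_def by blast
  then obtain a t where a: "\<And>i. i \<in> J \<Longrightarrow> a i \<in> X" "\<And>i. i \<in> J \<Longrightarrow> coloured g k (t i) i (a i)"
    by metis
  have finJ: "finite J" unfolding J_def by simp
  obtain s0 where s0: "\<And>s x. s \<ge> s0 \<Longrightarrow> x \<in> a ` J \<Longrightarrow> g x s \<longleftrightarrow> x \<in> X"
    using eventually_fixed[of g X "a ` J", OF lim finite_imageI[OF finJ]] by metis
  \<comment> \<open>By stage \<open>s1\<close> every colour in \<open>J\<close> is on its chosen
    representative in \<open>X\<close>, and the approximation has accepted these representatives for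
    good.\<close>
  define s1 where "s1 = s0 + (\<Sum>i\<in>J. t i)"
  have hit: "missed g k s (painting g k s) \<notin> J" if "s \<ge> s1" for s
  proof
    assume *: "missed g k s (painting g k s) \<in> J" (is "?i \<in> J")
    have "t ?i \<le> s" using member_le_sum[of ?i J t] finJ * that unfolding s1_def by simp
    then have "coloured g k s ?i (a ?i)" using coloured_mono[OF k _ a(2)[OF *]] by blast
    then have "\<not> g (a ?i) s" using missed_prop[where i = "a ?i - k" and st = "painting g k s" and k = k and g = g and s = s] unfolding coloured_def by simp
    moreover have "g (a ?i) s" using s0[of s "a ?i"] a(1)[OF *] * that unfolding s1_def by simp
    ultimately show False by blast
  qed
  show False
  proof (cases "\<exists>s. \<forall>t\<ge>s. m t = m s")
    \<comment> \<open>Colouring stops, so no colour is missed any more; once the approximation is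
      right on all coloured numbers, colour \<open>j\<close> lies on a true member of
      \<open>X\<close>.\<close>
    case True
    then obtain s where s: "\<And>t. t \<ge> s \<Longrightarrow> m t = m s" by blast
    obtain s2 where s2: "\<And>t x. t \<ge> s2 \<Longrightarrow> x \<in> {..<k + m s} \<Longrightarrow> g x t \<longleftrightarrow> x \<in> X"
      using eventually_fixed[of g X "{..<k + m s}", OF lim finite_lessThan] by metis
    define u where "u = max s s2"
    have "m (Suc u) = m u" using s[of u] s[of "Suc u"] unfolding u_def by simp
    then have "k \<le> missed g k u (painting g k u)"
      unfolding m_def by (auto simp: painting_Suc Let_def split: if_splits)
    from missed_ge[OF k this j] obtain i where i: "i < m u" "colour k (psnd (painting g k u)) i = j" "g (k + i) u"
      unfolding m_def by blast
    have "k + i \<in> X" using s2[of u "k + i"] i s[of u] unfolding u_def by simp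
    moreover have "coloured g k u j (k + i)" using i unfolding coloured_def m_def by simp
    ultimately show False using no_j by blast
  next
    case False
    have unbounded: "\<exists>s. n \<le> m s" for n
    proof (induction n)
      case (Suc n)
      then obtain s where s: "n \<le> m s" by blast
      obtain u where u: "u \<ge> s" "m u \<noteq> m s" using False by blast
      then have "m s < m u" using pfst_painting_mono[of s u g k] unfolding m_def by simp
      then show ?case using s by (intro exI[of _ u]) simp
    qed simp
    \<comment> \<open>\<open>x\<close> is still uncoloured at \<open>s1\<close>. The stage that
      colours it uses a missed colour, hence one outside \<open>J\<close>, although that colour then
      occurs on \<open>X\<close>.\<close>
    obtain x where x: "x \<in> X" "k + m s1 \<le> x" using inf by (meson infinite_nat_iff_unbounded_le)
    define s where "s = (LEAST s. x - k < m s)"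
    have less: "x - k < m s" unfolding s_def using unbounded[of "Suc (x - k)"] by (auto intro: LeastI simp: Suc_le_eq)
    have "s1 < s"
    proof (rule ccontr)
      assume "\<not> s1 < s"
      then have "m s \<le> m s1" using pfst_painting_mono[of s s1 g k] unfolding m_def by simp
      then show False using less x(2) by linarith
    qed
    then obtain u where u: "s = Suc u" "s1 \<le> u" by (cases s) auto
    have not: "m u \<le> x - k" using not_less_Least[of u "\<lambda>s. x - k < m s"] u(1) unfolding s_def[symmetric] by simp
    define i where "i = missed g k u (painting g k u)"
    have i: "i < k" using less not unfolding u(1) m_def i_def by (auto simp: painting_Suc Let_def split: if_splits)
    then have st: "painting g k s = prod_encode (Suc (m u), psnd (painting g k u) + i * k ^ m u)"
      unfolding u(1) m_def i_def by (simp add: painting_Suc Let_def)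
    then have "x - k = m u" using less not unfolding m_def by simp
    then have "coloured g k s i x" using x(2) st colour_append_new[OF painting_bound[OF k] i, of g u]
      unfolding coloured_def m_def by simp
    then have "i \<in> J" using i x(1) unfolding J_def by blast
    then show False using hit[OF u(2)] unfolding i_def by blast
  qed
qed

section \<open>Binary strings\<close>

text \<open>Kraft's inequality: incomparable strings have disjoint sets of extensions of length
  \<open>N\<close>.\<close>

lemma kraft_finite:
  fixes P :: "bool list set"
  assumes "finite P" "\<And>\<sigma>. \<sigma> \<in> P \<Longrightarrow> length \<sigma> \<le> N"
    and pf: "\<And>\<sigma> \<tau>. \<sigma> \<in> P \<Longrightarrow> \<tau> \<in> P \<Longrightarrow> prefix \<sigma> \<tau> \<Longrightarrow> \<sigma> = \<tau>"
  shows "(\<Sum>\<sigma>\<in>P. 2 ^ (N - length \<sigma>)) \<le> (2::nat) ^ N"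
proof -
  define B where "B \<sigma> = (\<lambda>\<tau>. \<sigma> @ \<tau>) ` {\<tau> :: bool list. length \<tau> = N - length \<sigma>}" for \<sigma>
  have card_lists: "card {\<tau> :: bool list. length \<tau> = l} = 2 ^ l" "finite {\<tau> :: bool list. length \<tau> = l}" for l
    using card_lists_length_eq[of "UNIV :: bool set" l] finite_lists_length_eq[of "UNIV :: bool set" l] by simp_all
  have cB: "card (B \<sigma>) = 2 ^ (N - length \<sigma>)" for \<sigma>
    unfolding B_def by (subst card_image) (auto simp: inj_on_def card_lists)
  have "(\<Sum>\<sigma>\<in>P. 2 ^ (N - length \<sigma>)) = card (\<Union>\<sigma>\<in>P. B \<sigma>)"
  proof (subst card_UN_disjoint)
    show "\<forall>\<sigma>\<in>P. \<forall>\<tau>\<in>P. \<sigma> \<noteq> \<tau> \<longrightarrow> B \<sigma> \<inter> B \<tau> = {}"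
    proof (intro ballI impI, rule ccontr)
      fix \<sigma> \<tau> assume *: "\<sigma> \<in> P" "\<tau> \<in> P" "\<sigma> \<noteq> \<tau>" "B \<sigma> \<inter> B \<tau> \<noteq> {}"
      then obtain \<rho> where "prefix \<sigma> \<rho>" "prefix \<tau> \<rho>" unfolding B_def by (auto simp: prefix_def)
      then have "prefix \<sigma> \<tau> \<or> prefix \<tau> \<sigma>" using prefix_same_cases by blast
      then show False using pf * by metis
    qed
  qed (use assms(1) in \<open>simp_all add: cB, simp add: B_def card_lists\<close>)
  also have "\<dots> \<le> card {\<tau> :: bool list. length \<tau> = N}"
    using assms(2) by (intro card_mono card_lists) (auto simp: B_def)
  finally show ?thesis by (simp add: card_lists)
qed

section \<open>Lengths and binary values of coded strings\<close>

definition str :: "nat \<Rightarrow> bool list" where "str = inv str_code"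
definition len :: "nat \<Rightarrow> nat" where "len a = length (str a)"
text \<open>Unlike in \<open>str_code\<close>, the first bit is the most significant, so that the
  extensions of a string by \<open>d\<close> bits fill one interval of \<open>2 ^ d\<close>
  values.\<close>

definition msb_value :: "bool list \<Rightarrow> nat" where
  "msb_value = foldl (\<lambda>v b. 2 * v + of_bool b) 0"

lemma str_str_code [simp]: "str (str_code \<sigma>) = \<sigma>" "str_code (str a) = a"
  using bij_str_code by (simp_all add: str_def inv_f_f bij_def surj_f_inv_f)

text \<open>By these bounds the length is the floor of the binary logarithm of
  \<open>Suc (str_code \<sigma>)\<close>, and codes are ordered by length first.\<close>

lemma str_code_bounds: "2 ^ length \<sigma> \<le> Suc (str_code \<sigma>)" "Suc (str_code \<sigma>) < 2 ^ Suc (length \<sigma>)"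
  by (induction \<sigma>) auto

lemma len_bounds: "2 ^ len a \<le> Suc a" "Suc a < 2 ^ Suc (len a)"
  using str_code_bounds[of "str a"] by (simp_all add: len_def)

lemma len_mono: assumes "a \<le> b" shows "len a \<le> len b"
proof -
  have "2 ^ len a < (2::nat) ^ Suc (len b)" using len_bounds(1)[of a] len_bounds(2)[of b] assms by linarith
  then have "len a < Suc (len b)" using power_less_imp_less_exp[of 2 "len a" "Suc (len b)"] by simp
  then show ?thesis by simp
qed

lemma len_le: "len a \<le> a"
  using len_bounds(1)[of a] less_exp[of "len a"] by linarith

lemma computable_len: assumes "computable A f" shows "computable A (\<lambda>x. len (f x))"
proof -
  have "computable A (\<lambda>x. LEAST l. Suc x < 2 ^ Suc l)"
  proof (rule computable_Least)
    show "\<exists>l. Suc x < 2 ^ Suc l" for x using len_bounds(2) by blast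
  qed (intro computable_intros)
  moreover have "(LEAST l. Suc x < 2 ^ Suc l) = len x" for x
  proof (rule Least_equality)
    show "Suc x < 2 ^ Suc (len x)" by (rule len_bounds)
    fix l assume "Suc x < 2 ^ Suc l"
    then have "2 ^ len x < (2::nat) ^ Suc l" using len_bounds(1)[of x] by linarith
    then have "len x < Suc l" using power_less_imp_less_exp[of 2 "len x" "Suc l"] by simp
    then show "len x \<le> l" by simp
  qed
  ultimately have "computable A len" by simp
  from computable_compose[OF this assms] show ?thesis .
qed

lemma computable_msb_value: assumes "computable A f" shows "computable A (\<lambda>x. msb_value (str (f x)))"
proof -
  \<comment> \<open>\<open>F\<close> moves the first bit of the string coded in the first component
    to the end of the binary value in the second. The empty string is a fixed point, so surplus
    iterations do no harm.\<close>
  define F where "F st = (if pfst st = 0 then st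
    else prod_encode ((pfst st - 1) div 2, 2 * psnd st + (1 - pfst st mod 2)))" for st
  have F: "(F ^^ k) (prod_encode (str_code \<sigma>, v)) = prod_encode (0, foldl (\<lambda>v b. 2 * v + of_bool b) v \<sigma>)"
    if "length \<sigma> \<le> k" for k \<sigma> v
    using that
  proof (induction k arbitrary: \<sigma> v)
    case (Suc k)
    show ?case
    proof (cases \<sigma>)
      case Nil
      have "(F ^^ i) (prod_encode (0, v)) = prod_encode (0, v)" for i by (induction i) (simp_all add: F_def)
      then show ?thesis using Nil by (simp del: funpow.simps)
    next
      case (Cons b \<tau>)
      have "F (prod_encode (str_code \<sigma>, v)) = prod_encode (str_code \<tau>, 2 * v + of_bool b)"
        by (auto simp: F_def Cons)
      moreover have "(F ^^ Suc k) st = (F ^^ k) (F st)" for st by (simp add: funpow_swap1)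
      ultimately show ?thesis using Suc Cons by (simp del: funpow.simps str_code.simps)
    qed
  qed simp
  have rec: "rec_nat st (\<lambda>m. F) k = (F ^^ k) st" for st k by (induction k) auto
  \<comment> \<open>\<open>x\<close> iterations suffice because
    \<open>len x \<le> x\<close>.\<close>
  have "computable A (\<lambda>x. psnd (rec_nat (prod_encode (x, 0)) (\<lambda>m. F) x))"
    unfolding F_def by (intro computable_intros computable_rec_nat)
  moreover have "psnd (rec_nat (prod_encode (x, 0)) (\<lambda>m. F) x) = msb_value (str x)" for x
    using F[of "str x" x 0] len_le[of x] by (simp add: rec msb_value_def len_def)
  ultimately have "computable A (\<lambda>x. msb_value (str x))" by simp
  from computable_compose[OF this assms] show ?thesis .
qed

lemma foldl_bits: "foldl (\<lambda>v b. 2 * v + of_bool b) (v::nat) \<mu> = v * 2 ^ length \<mu> + msb_value \<mu>"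
proof (induction \<mu> rule: rev_induct)
  case (snoc b \<mu>)
  then show ?case by (simp add: msb_value_def algebra_simps)
qed (simp add: msb_value_def)

lemma msb_value_append: "msb_value (\<mu> @ \<nu>) = msb_value \<mu> * 2 ^ length \<nu> + msb_value \<nu>"
  unfolding msb_value_def foldl_append by (rule foldl_bits[unfolded msb_value_def])

lemma msb_value_less: "msb_value \<mu> < 2 ^ length \<mu>"
  by (induction \<mu> rule: rev_induct) (auto simp: msb_value_def)

lemma msb_value_exists: "v < 2 ^ l \<Longrightarrow> \<exists>\<mu>. length \<mu> = l \<and> msb_value \<mu> = v"
proof (induction l arbitrary: v)
  case (Suc l)
  have "v div 2 < 2 ^ l" using Suc.prems by (simp add: less_mult_imp_div_less)
  from Suc.IH[OF this] obtain \<mu> where "length \<mu> = l" "msb_value \<mu> = v div 2" by auto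
  then show ?case by (intro exI[of _ "\<mu> @ [odd v]"]) (simp add: msb_value_append, simp add: msb_value_def mult.commute)
qed (simp add: msb_value_def)

section \<open>Compressing a light colour class\<close>

text \<open>Allowing any certificate up to \<open>s\<close> makes this monotone in the stage, unlike
  \<open>halts_by\<close>.\<close>

definition graph_by :: "nat \<Rightarrow> nat \<Rightarrow> nat \<Rightarrow> nat \<Rightarrow> bool" where
  "graph_by e s a b \<longleftrightarrow> (\<exists>D\<le>s. certifies D e a b)"

definition dom_by :: "nat \<Rightarrow> nat \<Rightarrow> nat \<Rightarrow> bool" where
  "dom_by e s a \<longleftrightarrow> (\<exists>b\<le>s. graph_by e s a b)"

definition candidate :: "(nat \<Rightarrow> nat \<Rightarrow> bool) \<Rightarrow> nat \<Rightarrow> nat \<Rightarrow> nat \<Rightarrow> nat \<Rightarrow> nat \<Rightarrow> bool" where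
  "candidate g e n s j a \<longleftrightarrow> coloured g (8 ^ n) s j a \<and> dom_by e s a"

text \<open>The weights \<open>2 ^ (- len a)\<close> are multiplied by \<open>2 ^ s\<close> to stay in the natural numbers.\<close>

definition weight :: "(nat \<Rightarrow> nat \<Rightarrow> bool) \<Rightarrow> nat \<Rightarrow> nat \<Rightarrow> nat \<Rightarrow> nat \<Rightarrow> nat" where
  "weight g e n s j = (\<Sum>a<s. of_bool (candidate g e n s j a) * 2 ^ (s - len a))"

definition lightest :: "(nat \<Rightarrow> nat \<Rightarrow> bool) \<Rightarrow> nat \<Rightarrow> nat \<Rightarrow> nat \<Rightarrow> nat" where
  "lightest g e n s = (LEAST j. 8 ^ n * weight g e n s j \<le> 2 ^ s)"

definition compressed :: "(nat \<Rightarrow> nat \<Rightarrow> bool) \<Rightarrow> nat \<Rightarrow> nat \<Rightarrow> nat \<Rightarrow> nat \<Rightarrow> bool" where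
  "compressed g e n s a \<longleftrightarrow> candidate g e n s (lightest g e n s) a"

text \<open>
  Numerical order of codes refines the order by length, so the cumulative weights of the members
  of \<open>C\<close> below \<open>a\<close> are multiples of the weight of \<open>a\<close>; \<open>position C a\<close> is the quotient. Written in
  binary with \<open>len a - 3 * n\<close> digits, most significant digit first, these numbers form the
  prefix-free code of Kraft's theorem.
\<close>

definition position :: "(nat \<Rightarrow> bool) \<Rightarrow> nat \<Rightarrow> nat" where
  "position C a = (\<Sum>b<a. of_bool (C b) * 2 ^ (len a - len b))"

text \<open>Singling out the least certificate lets \<open>n\<close> determine the stage and thereby
  the class to be compressed.\<close>

definition enters :: "nat \<Rightarrow> nat \<Rightarrow> bool" where
  "enters n s \<longleftrightarrow> halts_by n s \<and> (\<forall>t<s. \<not> halts_by n t)"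

text \<open>The equation for \<open>x\<close> means that \<open>x\<close> codes the string \<open>1\<^sup>n 0 str c\<close>.\<close>

definition describes :: "(nat \<Rightarrow> nat \<Rightarrow> bool) \<Rightarrow> nat \<Rightarrow> nat \<Rightarrow> nat \<Rightarrow> nat \<Rightarrow> nat \<Rightarrow> nat \<Rightarrow> nat \<Rightarrow> bool" where
  "describes g e x n c a b s \<longleftrightarrow> x + 2 = 2 ^ n * (2 * c + 3) \<and> enters n s \<and> compressed g e n s a \<and>
     len c = len a - 3 * n \<and> msb_value (str c) = position (compressed g e n s) a \<and> graph_by e s a b"

abbreviation describes_code :: "(nat \<Rightarrow> nat \<Rightarrow> bool) \<Rightarrow> nat \<Rightarrow> nat \<Rightarrow> nat \<Rightarrow> bool" where
  "describes_code g e x w \<equiv> describes g e x (pfst w) (pfst (psnd w)) (pfst (psnd (psnd w)))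
     (pfst (psnd (psnd (psnd w)))) (psnd (psnd (psnd (psnd w))))"

definition compressor :: "(nat \<Rightarrow> nat \<Rightarrow> bool) \<Rightarrow> nat \<Rightarrow> bool list \<rightharpoonup> bool list" where
  "compressor g e \<sigma> = (if \<exists>w. describes_code g e (str_code \<sigma>) w
     then Some (str (pfst (psnd (psnd (psnd (LEAST w. describes_code g e (str_code \<sigma>) w)))))) else None)"

section \<open>Computability of the construction\<close>

lemma computable_colour: "computable A f \<Longrightarrow> computable A h \<Longrightarrow> computable A i \<Longrightarrow> computable A (\<lambda>x. colour (f x) (h x) (i x))"
  unfolding colour_def by (intro computable_intros)

lemma decidable_graph_by:
  assumes "computable A f" "computable A h" "computable A i" "computable A j"
  shows "decidable A (\<lambda>x. graph_by (f x) (h x) (i x) (j x))"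
  unfolding graph_by_def
  by (intro decidable_ex_le decidable_certifies assms assms[THEN computable_compose] computable_intros)

lemma decidable_dom_by:
  assumes "computable A f" "computable A h" "computable A i"
  shows "decidable A (\<lambda>x. dom_by (f x) (h x) (i x))"
  unfolding dom_by_def
  by (intro decidable_ex_le decidable_graph_by assms assms[THEN computable_compose] computable_intros)

lemma decidable_enters:
  assumes "computable A f" "computable A h" shows "decidable A (\<lambda>x. enters (f x) (h x))"
  unfolding enters_def
  by (intro decidable_conj decidable_not decidable_all_less decidable_halts_by assms assms[THEN computable_compose] computable_intros)

context
  fixes A :: "nat set" and g :: "nat \<Rightarrow> nat \<Rightarrow> bool"
  assumes decidable_g: "decidable A (\<lambda>z. g (pfst z) (psnd z))"
begin

lemma decidable_approx: "computable A f \<Longrightarrow> computable A h \<Longrightarrow> decidable A (\<lambda>x. g (f x) (h x))"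
  using computable_apply2[of A "\<lambda>a b. of_bool (g a b)" f h] decidable_g unfolding decidable_def by simp

lemma computable_missed: "computable A f \<Longrightarrow> computable A h \<Longrightarrow> computable A i \<Longrightarrow> computable A (\<lambda>x. missed g (f x) (h x) (i x))"
proof (rule computable_apply3[of A "missed g"])
  show "computable A (\<lambda>z. missed g (pfst z) (pfst (psnd z)) (psnd (psnd z)))"
    unfolding missed_def
    by (rule computable_Least) (intro computable_intros decidable_approx computable_colour, rule missed_total)
qed

lemma computable_painting: "computable A f \<Longrightarrow> computable A h \<Longrightarrow> computable A (\<lambda>x. painting g (f x) (h x))"
proof (rule computable_apply2[of A "painting g"])
  show "computable A (\<lambda>z. painting g (pfst z) (psnd z))"
    unfolding painting_def by (intro computable_rec_nat computable_intros computable_missed)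
qed

text \<open>The oracle is left open: \<open>{}\<close> serves the machine, the set of codes of
  \<open>S\<close> the final algorithm.\<close>

lemma decidable_candidate:
  assumes "computable A f" "computable A h" "computable A i" "computable A j"
  shows "decidable A (\<lambda>x. candidate g e (f x) (h x) (i x) (j x))"
  unfolding candidate_def coloured_def by (intro computable_intros computable_painting computable_colour decidable_dom_by assms)

lemma computable_weight:
  assumes "computable A f" "computable A h" "computable A i"
  shows "computable A (\<lambda>x. weight g e (f x) (h x) (i x))"
  unfolding weight_def
  by (intro computable_sum computable_mult decidable_candidate[unfolded decidable_def] computable_len assms assms[THEN computable_compose] computable_intros)

lemma computable_lightest: "computable A f \<Longrightarrow> computable A h \<Longrightarrow> computable A (\<lambda>x. lightest g e (f x) (h x))"
proof (rule computable_apply2[of A "lightest g e"])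
  show "computable A (\<lambda>z. lightest g e (pfst z) (psnd z))"
    unfolding lightest_def
  proof (rule computable_Least)
    fix z
    \<comment> \<open>The index \<open>8 ^ n\<close> is not a colour, so its class is empty and has
      weight 0; thus the search ends for every \<open>e\<close>.\<close>
    have "\<not> candidate g e n s (8 ^ n) a" for n s a
      using colour_less[of "8 ^ n"] unfolding candidate_def coloured_def by (metis less_irrefl zero_less_numeral zero_less_power)
    then have "weight g e (pfst z) (psnd z) (8 ^ pfst z) = 0" by (simp add: weight_def)
    then show "\<exists>j. 8 ^ pfst z * weight g e (pfst z) (psnd z) j \<le> 2 ^ psnd z" by (metis mult_0_right zero_le)
  qed (intro computable_intros computable_weight)
qed

lemma decidable_compressed:
  assumes "computable A f" "computable A h" "computable A i" shows "decidable A (\<lambda>x. compressed g e (f x) (h x) (i x))"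
  unfolding compressed_def by (intro decidable_candidate computable_lightest assms)

lemma computable_position:
  assumes "computable A f" "computable A h" "computable A i"
  shows "computable A (\<lambda>x. position (compressed g e (f x) (h x)) (i x))"
  unfolding position_def
  by (intro computable_sum computable_mult decidable_compressed[unfolded decidable_def] computable_len assms assms[THEN computable_compose] computable_intros)

lemma decidable_describes_code:
  assumes "computable A f" "computable A h" shows "decidable A (\<lambda>x. describes_code g e (f x) (h x))"
  unfolding describes_def
  by (intro computable_intros decidable_enters decidable_compressed computable_position computable_len computable_msb_value decidable_graph_by assms)

end

lemma partial_computable_compressor:
  assumes "decidable {} (\<lambda>z. g (pfst z) (psnd z))" shows "partial_computable (compressor g e)"
proof -
  have "decidable {} (\<lambda>z. describes_code g e (pfst z) (psnd z))"
    by (intro decidable_describes_code[OF assms] computable_intros)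
  moreover have "computable {} (\<lambda>w. pfst (psnd (psnd (psnd w))))" by (intro computable_intros)
  ultimately obtain p where p: "\<And>x. run {} p x = (if \<exists>w. describes_code g e x w
     then Some (pfst (psnd (psnd (psnd (LEAST w. describes_code g e x w))))) else None)"
    using partial_search[of "{}" "describes_code g e"] by blast
  show ?thesis unfolding partial_computable_def
    by (rule exI[of _ p]) (simp add: p compressor_def)
qed

section \<open>Kraft's prefix-free code and its header\<close>

lemma position_less:
  assumes "8 ^ n * (\<Sum>a<s. of_bool (C a) * 2 ^ (s - len a)) \<le> (2::nat) ^ s" "C a" "a < s" "3 * n \<le> len a"
  shows "position C a < 2 ^ (len a - 3 * n)"
proof -
  have la: "len a \<le> s" using len_le[of a] assms(3) by simp
  \<comment> \<open>One more than the position of \<open>a\<close>, in units of the weight of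
    \<open>a\<close>, is the weight of the class up to and including \<open>a\<close>.\<close>
  have "2 ^ (s - len a) * (position C a + 1) = (\<Sum>b<Suc a. of_bool (C b) * 2 ^ (s - len b))"
  proof -
    have "2 ^ (s - len a) * 2 ^ (len a - len b) = (2::nat) ^ (s - len b)" if "b < a" for b
      using la len_mono[of b a] that by (simp add: power_add[symmetric])
    then have "2 ^ (s - len a) * position C a = (\<Sum>b<a. of_bool (C b) * 2 ^ (s - len b))"
      unfolding position_def sum_distrib_left by (intro sum.cong) auto
    then show ?thesis using assms(2) by simp
  qed
  also have "\<dots> \<le> (\<Sum>b<s. of_bool (C b) * 2 ^ (s - len b))"
    using assms(3) by (intro sum_mono2) auto
  finally have "8 ^ n * (2 ^ (s - len a) * (position C a + 1)) \<le> 2 ^ s"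
    using assms(1) by (meson le_trans mult_le_mono2)
  also have "(2::nat) ^ s = 8 ^ n * (2 ^ (s - len a) * 2 ^ (len a - 3 * n))"
  proof -
    have "(8::nat) ^ n = 2 ^ (3 * n)" by (simp add: power_mult)
    then show ?thesis using la assms(4) by (simp add: power_add[symmetric])
  qed
  finally have "position C a + 1 \<le> 2 ^ (len a - 3 * n)" by (simp only: nat_mult_le_cancel_disj) simp
  then show ?thesis by simp
qed

text \<open>The sum for \<open>position C b\<close> contains the terms of all members up to and
  including \<open>a\<close>, rescaled from the length of \<open>a\<close> to that of
  \<open>b\<close>.\<close>

lemma position_gap:
  assumes "C a" "a < b"
  shows "2 ^ (len b - len a) * (position C a + 1) \<le> position C b"
proof -
  have "2 ^ (len b - len a) * 2 ^ (len a - len c) = (2::nat) ^ (len b - len c)" if "c < a" for c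
    using len_mono[of c a] len_mono[of a b] that assms(2) by (simp add: power_add[symmetric])
  then have "2 ^ (len b - len a) * position C a = (\<Sum>c<a. of_bool (C c) * 2 ^ (len b - len c))"
    unfolding position_def sum_distrib_left by (intro sum.cong) auto
  then have "2 ^ (len b - len a) * (position C a + 1) = (\<Sum>c<Suc a. of_bool (C c) * 2 ^ (len b - len c))"
    using assms(1) by simp
  also have "\<dots> \<le> position C b" unfolding position_def using assms(2) by (intro sum_mono2) auto
  finally show ?thesis .
qed

text \<open>If \<open>a < b\<close>, an extension of \<open>\<mu>\<close> has too small a value by
  \<open>position_gap\<close>. If \<open>b < a\<close>, the lengths and hence the values agree,
  which \<open>position_gap\<close> excludes as well.\<close>

lemma position_code_prefix_free:
  assumes "C a" "C b" "3 * n \<le> len a" "3 * n \<le> len b"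
    and \<mu>: "length \<mu> = len a - 3 * n" "msb_value \<mu> = position C a"
    and \<nu>: "length \<nu> = len b - 3 * n" "msb_value \<nu> = position C b"
    and "prefix \<mu> \<nu>"
  shows "a = b"
proof -
  obtain \<kappa> where \<kappa>: "\<nu> = \<mu> @ \<kappa>" using assms(9) by (auto simp: prefix_def)
  then have l: "length \<kappa> = len b - len a" "len a \<le> len b" using \<mu>(1) \<nu>(1) assms(3,4) by auto
  have v: "position C b < 2 ^ (len b - len a) * (position C a + 1)"
    using msb_value_less[of \<kappa>] \<mu>(2) \<nu>(2) l(1) by (simp add: \<kappa> msb_value_append mult.commute)
  have False if "a < b" using position_gap[of C a b, OF assms(1) that] v by simp
  moreover have False if "b < a"
  proof -
    have "len a = len b" using len_mono[of b a] that l(2) by simp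
    then have "position C b + 1 \<le> position C a" "\<kappa> = []" using position_gap[of C b a, OF assms(2) that] l(1) by simp_all
    then show False using \<kappa> \<mu>(2) \<nu>(2) by simp
  qed
  ultimately show ?thesis by (meson linorder_cases)
qed

lemma str_code_header: "str_code (replicate n True @ False # \<mu>) + 2 = 2 ^ n * (2 * str_code \<mu> + 3)"
  by (induction n) auto

lemma str_header: "x + 2 = 2 ^ n * (2 * c + 3) \<Longrightarrow> str x = replicate n True @ False # str c"
proof -
  assume "x + 2 = 2 ^ n * (2 * c + 3)"
  then have "x = str_code (replicate n True @ False # str c)" using str_code_header[of n "str c"] by simp
  then show ?thesis by simp
qed

text \<open>The header is self-delimiting, so the codes for all \<open>n\<close> can share one
  prefix-free machine.\<close>

lemma prefix_header:
  "prefix (replicate n True @ False # \<mu>) (replicate m True @ False # \<nu>) \<longleftrightarrow> n = m \<and> prefix \<mu> \<nu>"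
proof (induction n arbitrary: m)
  case 0 then show ?case by (cases m) auto
next
  case (Suc n) then show ?case by (cases m) auto
qed

lemma enters_unique: "enters n s \<Longrightarrow> enters n t \<Longrightarrow> s = t"
  unfolding enters_def by (meson linorder_cases)

text \<open>Only numbers from \<open>8 ^ n\<close> on are coloured. Hence
  \<open>len a - 3 * n\<close> is a true difference.\<close>

lemma compressed_len: "compressed g e n s a \<Longrightarrow> 3 * n \<le> len a"
proof -
  assume "compressed g e n s a"
  then have "(2::nat) ^ (3 * n) \<le> a" by (simp add: compressed_def candidate_def coloured_def power_mult)
  then have "(2::nat) ^ (3 * n) < 2 ^ Suc (len a)" using len_bounds(2)[of a] by linarith
  then have "3 * n < Suc (len a)" using power_less_imp_less_exp[of 2 "3 * n" "Suc (len a)"] by simp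
  then show ?thesis by simp
qed

section \<open>Light classes and correctness of the compressor\<close>

context
  fixes U :: "bool list \<rightharpoonup> bool list" and p :: prog and e :: nat
  assumes U: "\<And>\<sigma>. run {} p (str_code \<sigma>) = map_option str_code (U \<sigma>)" and e: "e = prog_code p"
    and U_prefix_free: "\<And>\<sigma> \<tau>. \<sigma> \<in> dom U \<Longrightarrow> \<tau> \<in> dom U \<Longrightarrow> prefix \<sigma> \<tau> \<Longrightarrow> \<sigma> = \<tau>"
begin

lemma graph_by_sound: "graph_by e s a b \<Longrightarrow> U (str a) = Some (str b)"
proof -
  assume "graph_by e s a b"
  then have "evaluates e a b" unfolding graph_by_def ex_certifies[symmetric] by blast
  then have "run {} p a = Some b" unfolding e evaluates_iff .
  then show ?thesis using U[of "str a"] by (auto simp: map_option_case split: option.splits)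
qed

lemma dom_by_sound: "dom_by e s a \<Longrightarrow> str a \<in> dom U"
  unfolding dom_by_def using graph_by_sound by blast

lemma dom_by_less: "dom_by e s a \<Longrightarrow> a < s"
  unfolding dom_by_def graph_by_def using certifies_less by fastforce

lemma dom_by_complete: "\<sigma> \<in> dom U \<Longrightarrow> \<exists>s. dom_by e s (str_code \<sigma>)"
proof -
  assume "\<sigma> \<in> dom U"
  then obtain \<tau> where "U \<sigma> = Some \<tau>" by blast
  then have "evaluates e (str_code \<sigma>) (str_code \<tau>)" unfolding e evaluates_iff U by simp
  then obtain D where D: "certifies D e (str_code \<sigma>) (str_code \<tau>)" using ex_certifies by blast
  then have "str_code \<tau> \<le> D" using certifies_less by fastforce
  then show ?thesis using D unfolding dom_by_def graph_by_def by blast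
qed

lemma dom_by_mono: "s \<le> t \<Longrightarrow> dom_by e s a \<Longrightarrow> dom_by e t a"
  unfolding dom_by_def graph_by_def by (meson le_trans)

text \<open>A number has at most one colour, so the classes are disjoint parts of a prefix-free set,
  whose total weight is bounded by Kraft's inequality.\<close>

lemma weight_sum: "(\<Sum>j<8 ^ n. weight g e n s j) \<le> 2 ^ s"
proof -
  have "(\<Sum>j<8 ^ n. weight g e n s j) =
      (\<Sum>a<s. \<Sum>j<8 ^ n. of_bool (candidate g e n s j a) * 2 ^ (s - len a))"
    unfolding weight_def by (rule sum.swap)
  also have "\<dots> \<le> (\<Sum>a<s. of_bool (dom_by e s a) * 2 ^ (s - len a))"
  proof (rule sum_mono)
    fix a
    have "(\<Sum>j<8 ^ n. of_bool (candidate g e n s j a)) \<le>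
        (\<Sum>j<8 ^ n. if j = colour (8 ^ n) (psnd (painting g (8 ^ n) s)) (a - 8 ^ n) then of_bool (dom_by e s a) else (0::nat))"
      by (intro sum_mono) (auto simp: candidate_def coloured_def)
    also have "\<dots> \<le> of_bool (dom_by e s a)" by (simp add: sum.delta')
    finally show "(\<Sum>j<8 ^ n. of_bool (candidate g e n s j a) * 2 ^ (s - len a)) \<le> of_bool (dom_by e s a) * (2::nat) ^ (s - len a)"
      unfolding sum_distrib_right[symmetric] by (rule mult_le_mono1)
  qed
  also have "\<dots> = (\<Sum>a\<in>{a. a < s \<and> dom_by e s a}. 2 ^ (s - len a))"
    by (simp add: sum.inter_filter[symmetric] of_bool_def if_distrib[of "\<lambda>x. x * _"] cong: if_cong)
  also have "\<dots> = (\<Sum>\<sigma>\<in>str ` {a. a < s \<and> dom_by e s a}. 2 ^ (s - length \<sigma>))"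
    by (subst sum.reindex) (auto simp: len_def intro!: inj_onI, metis str_str_code(2))
  also have "\<dots> \<le> 2 ^ s"
  proof (rule kraft_finite)
    fix \<sigma> assume "\<sigma> \<in> str ` {a. a < s \<and> dom_by e s a}"
    then show "length \<sigma> \<le> s" using len_le unfolding len_def by (auto intro: order_trans less_imp_le)
  qed (use U_prefix_free dom_by_sound in auto)
  finally show ?thesis .
qed

text \<open>Averaging: the \<open>8 ^ n\<close> classes cannot all exceed an equal share of
  \<open>2 ^ s\<close>.\<close>

lemma lightest_prop: "lightest g e n s < 8 ^ n" "8 ^ n * weight g e n s (lightest g e n s) \<le> 2 ^ s"
proof -
  have "\<exists>j<8 ^ n. 8 ^ n * weight g e n s j \<le> 2 ^ s"
  proof (rule ccontr)
    assume "\<not> ?thesis"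
    then have "(\<Sum>j<(8::nat) ^ n. 2 ^ s) < (\<Sum>j<8 ^ n. 8 ^ n * weight g e n s j)"
      by (intro sum_strict_mono) (auto simp: not_le lessThan_empty_iff)
    then have "8 ^ n * 2 ^ s < 8 ^ n * (\<Sum>j<8 ^ n. weight g e n s j)" by (simp add: sum_distrib_left)
    then show False using weight_sum[of g n s] by simp
  qed
  then obtain j where j: "j < 8 ^ n" "8 ^ n * weight g e n s j \<le> 2 ^ s" by blast
  show "8 ^ n * weight g e n s (lightest g e n s) \<le> 2 ^ s"
    unfolding lightest_def by (rule LeastI[of "\<lambda>j. 8 ^ n * weight g e n s j \<le> 2 ^ s", OF j(2)])
  show "lightest g e n s < 8 ^ n"
    using Least_le[of "\<lambda>j. 8 ^ n * weight g e n s j \<le> 2 ^ s", OF j(2)] j(1) unfolding lightest_def by simp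
qed

text \<open>The header fixes \<open>n\<close>, \<open>n\<close> fixes the stage and so the class,
  the Kraft code fixes \<open>a\<close>, and \<open>a\<close> fixes \<open>b\<close> because
  \<open>U\<close> is a function. For two strings this gives prefix-freeness; for a single one,
  independence of the witness.\<close>

lemma describes_prefix:
  assumes "describes g e x n c a b s" "describes g e x' n' c' a' b' s'" "prefix (str x) (str x')"
  shows "x = x' \<and> a = a' \<and> b = b'"
proof -
  have "prefix (replicate n True @ False # str c) (replicate n' True @ False # str c')"
    using assms str_header unfolding describes_def by metis
  then have n: "n = n'" and pre: "prefix (str c) (str c')" unfolding prefix_header by auto
  have s: "s = s'" using assms(1,2) enters_unique n unfolding describes_def by blast
  have a: "a = a'"
    by (rule position_code_prefix_free[of "compressed g e n s" a a' n "str c" "str c'"])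
      (use assms(1,2) n s compressed_len pre in \<open>auto simp: describes_def len_def\<close>)
  have "length (str c) = length (str c')" using assms(1,2) n a by (simp add: describes_def len_def)
  then have "c = c'" using pre by (metis not_equal_is_parallel parallelE prefix_length_prefix prefix_order.eq_iff str_str_code(2) order_refl)
  then have "x = x'" using assms(1,2) n unfolding describes_def by simp
  moreover have "str b = str b'" using assms(1,2) a graph_by_sound unfolding describes_def by (metis option.inject)
  ultimately show ?thesis using a by (metis str_str_code(2))
qed

lemma compressor_describes:
  assumes "describes g e (str_code \<sigma>) n c a b s" shows "compressor g e \<sigma> = Some (str b)"
proof -
  have ex: "\<exists>w. describes_code g e (str_code \<sigma>) w"
    by (rule exI[of _ "prod_encode (n, prod_encode (c, prod_encode (a, prod_encode (b, s))))"]) (simp add: assms)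
  from describes_prefix[OF LeastI_ex[OF ex] assms] ex show ?thesis unfolding compressor_def by simp
qed

lemma prefix_free_compressor:
  assumes "decidable {} (\<lambda>z. g (pfst z) (psnd z))" shows "prefix_free_machine (compressor g e)"
  unfolding prefix_free_machine_def
proof (intro conjI ballI impI partial_computable_compressor assms)
  fix \<sigma> \<tau> assume *: "\<sigma> \<in> dom (compressor g e)" "\<tau> \<in> dom (compressor g e)" "prefix \<sigma> \<tau>"
  then obtain v w where "describes_code g e (str_code \<sigma>) v" "describes_code g e (str_code \<tau>) w"
    unfolding compressor_def by (auto split: if_splits)
  from describes_prefix[OF this] *(3) show "\<sigma> = \<tau>" by (metis str_str_code(1))
qed

text \<open>The header takes \<open>n + 1\<close> bits and the Kraft codeword the rest, so the
  saving over \<open>len a\<close> grows like \<open>2 * n\<close>.\<close>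

lemma K_compressor:
  assumes "enters n s" "compressed g e n s a" "U (str a) = Some y"
  shows "K (compressor g e) y \<le> enat (n + 1 + (len a - 3 * n))"
proof -
  have dom: "dom_by e s a" using assms(2) by (simp add: compressed_def candidate_def)
  then obtain b where b: "graph_by e s a b" unfolding dom_by_def by blast
  have "position (compressed g e n s) a < 2 ^ (len a - 3 * n)"
    by (rule position_less[where n = n and s = s])
      (use lightest_prop(2)[of n g s] assms(2) dom_by_less[OF dom] compressed_len in \<open>auto simp: weight_def compressed_def\<close>)
  then obtain \<mu> where \<mu>: "length \<mu> = len a - 3 * n" "msb_value \<mu> = position (compressed g e n s) a"
    using msb_value_exists by blast
  have "describes g e (str_code (replicate n True @ False # \<mu>)) n (str_code \<mu>) a b s"
    unfolding describes_def using assms(1,2) \<mu> b str_code_header[of n \<mu>] by (simp add: len_def)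
  from compressor_describes[OF this] have "compressor g e (replicate n True @ False # \<mu>) = Some y"
    using graph_by_sound[OF b] assms(3) by simp
  then have "K (compressor g e) y \<le> enat (length (replicate n True @ False # \<mu>))"
    unfolding K_def by (intro INF_lower) simp
  then show ?thesis using \<mu> by simp
qed

text \<open>This makes the oracle search of the final algorithm end. A single stage serves all
  colours because candidates persist.\<close>

lemma ex_all_candidates:
  assumes "\<And>x. \<exists>s0. \<forall>s\<ge>s0. g x s \<longleftrightarrow> x \<in> str_code ` S" "infinite S" "S \<subseteq> dom U"
  shows "\<exists>t. \<forall>j<8 ^ n. \<exists>a<t. a \<in> str_code ` S \<and> candidate g e n t j a"
proof -
  have inf: "infinite (str_code ` S)" using assms(2) bij_str_code by (meson bij_is_inj finite_imageD inj_on_subset subset_UNIV)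
  have "\<exists>a t. a \<in> str_code ` S \<and> candidate g e n t j a" if j: "j < 8 ^ n" for j
  proof -
    obtain a s where a: "a \<in> str_code ` S" "coloured g (8 ^ n) s j a"
      using all_colours_hit[of g "str_code ` S", OF assms(1) inf j] by blast
    then obtain s' where "dom_by e s' a" using dom_by_complete assms(3) by blast
    then have "candidate g e n (max s s') j a" unfolding candidate_def
      using a(2) coloured_mono[of "8 ^ n" s "max s s'"] dom_by_mono[of s' "max s s'"] by simp
    then show ?thesis using a by blast
  qed
  then obtain a t where at: "\<And>j. j < 8 ^ n \<Longrightarrow> a j \<in> str_code ` S" "\<And>j. j < 8 ^ n \<Longrightarrow> candidate g e n (t j) j (a j)"
    by metis
  define T where "T = (\<Sum>j<8 ^ n. t j)"
  have "a j < T \<and> candidate g e n T j (a j)" if "j < 8 ^ n" for j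
  proof -
    have "t j \<le> T" unfolding T_def using member_le_sum[of j "{..<8 ^ n}" t] that by simp
    then have "coloured g (8 ^ n) T j (a j)" "dom_by e T (a j)"
      using at(2)[OF that] coloured_mono[of "8 ^ n" "t j" T g j "a j"] dom_by_mono[of "t j" T "a j"]
      unfolding candidate_def by simp_all
    then show ?thesis using dom_by_less[of T "a j"] unfolding candidate_def by simp
  qed
  with at(1) show ?thesis by (intro exI[of _ T]) metis
qed

end

section \<open>Computing the halting problem from \<open>S\<close>\<close>

theorem theorem1p6:
  fixes U :: "bool list \<rightharpoonup> bool list" and S :: "bool list set"
  assumes "universal_prefix_free_machine U"
    and "infinite S"
    and "Delta02 (str_code ` S)"
    and "S \<subseteq> minimal_descriptions U"
  shows "jump {} \<le>\<^sub>T str_code ` S"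
proof -
  define X where "X = str_code ` S"
  have pfU: "prefix_free_machine U"
    and opt: "\<And>M. prefix_free_machine M \<Longrightarrow> \<exists>c. \<forall>x. K U x \<le> K M x + enat c"
    using assms(1) unfolding universal_prefix_free_machine_def by blast+
  obtain p where p: "\<And>\<sigma>. run {} p (str_code \<sigma>) = map_option str_code (U \<sigma>)"
    using pfU unfolding prefix_free_machine_def partial_computable_def by blast
  define e where "e = prog_code p"
  have pf: "\<And>\<sigma> \<tau>. \<sigma> \<in> dom U \<Longrightarrow> \<tau> \<in> dom U \<Longrightarrow> prefix \<sigma> \<tau> \<Longrightarrow> \<sigma> = \<tau>"
    using pfU unfolding prefix_free_machine_def by blast
  note U = p e_def pf
  obtain g where decidable_g: "decidable {} (\<lambda>z. g (pfst z) (psnd z))"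
    and g: "\<And>x. \<exists>s0. \<forall>s\<ge>s0. g x s \<longleftrightarrow> x \<in> str_code ` S"
    using limit_approximation[OF assms(3)] by blast
  have decidable_gX: "decidable X (\<lambda>z. g (pfst z) (psnd z))" using decidable_g computable_any_oracle unfolding decidable_def by blast
  obtain c where c: "\<And>x. K U x \<le> K (compressor g e) x + enat c"
    using opt[OF prefix_free_compressor[of p U e, OF U decidable_g]] by blast
  have avoid: "n \<le> c" if n: "enters n s" "compressed g e n s a" "a \<in> X" for n s a
  proof -
    obtain \<sigma> where \<sigma>: "a = str_code \<sigma>" "\<sigma> \<in> S" using n(3) unfolding X_def by blast
    then obtain y where y: "U \<sigma> = Some y" "enat (length \<sigma>) = K U y"
      using assms(4) unfolding minimal_descriptions_def by auto
    \<comment> \<open>As \<open>3 * n \<le> len a\<close>, this amounts to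
      \<open>2 * n \<le> c + 1\<close>, whence \<open>n \<le> c\<close>.\<close>
    have "enat (len a) \<le> enat (n + 1 + (len a - 3 * n)) + enat c"
      using K_compressor[of p U e, OF U n(1,2), of y] c[of y] y \<sigma>(1)
      by (metis add_right_mono len_def order_trans str_str_code(1))
    then show ?thesis using compressed_len[OF n(2)] by simp
  qed
  have ex: "\<exists>t. \<forall>j<8 ^ n. \<exists>a<t. a \<in> X \<and> candidate g e n t j a" for n
    unfolding X_def using assms(4) unfolding minimal_descriptions_def
    by (intro ex_all_candidates[of p U e, OF U g assms(2)]) auto
  \<comment> \<open>The bound \<open>a < t\<close> keeps the condition decidable with oracle
    \<open>X\<close>.\<close>
  define settled where "settled n = (LEAST t. \<forall>j<8 ^ n. \<exists>a<t. a \<in> X \<and> candidate g e n t j a)" for n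
  have computable_settled: "computable X settled"
    unfolding settled_def
    by (rule computable_Least) (intro computable_intros decidable_oracle decidable_candidate[OF decidable_gX], rule ex)
  have settled: "\<forall>j<8 ^ n. \<exists>a<settled n. a \<in> X \<and> candidate g e n (settled n) j a" for n
    unfolding settled_def by (rule LeastI_ex[OF ex])
  have halt: "n \<in> jump {} \<longleftrightarrow> (\<exists>D\<le>settled n. halts_by n D)" if "c < n" for n
  proof
    assume "n \<in> jump {}"
    then have hex: "\<exists>D. halts_by n D" using jump_iff_halts_by by blast
    define s where "s = (LEAST D. halts_by n D)"
    have s: "enters n s" unfolding enters_def s_def using LeastI_ex[OF hex] not_less_Least by blast
    have "s \<le> settled n"
    proof (rule ccontr)
      assume "\<not> s \<le> settled n"
      then have le: "settled n \<le> s" by simp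
      \<comment> \<open>The lightest class at stage \<open>s\<close> already had a member in
        \<open>X\<close> at stage \<open>settled n\<close>. It is still a candidate at
        \<open>s\<close>, so it is compressed, against \<open>avoid\<close> and
        \<open>c < n\<close>.\<close>
      define j where "j = lightest g e n s"
      have "j < 8 ^ n" unfolding j_def by (rule lightest_prop(1)[of p U e, OF U])
      then obtain a where a: "a \<in> X" "candidate g e n (settled n) j a" using settled by blast
      then have "candidate g e n s j a" unfolding candidate_def
        using coloured_mono[OF _ le, of "8 ^ n" g j a] dom_by_mono[of p U e, OF U le] by simp
      then have "compressed g e n s a" unfolding compressed_def j_def .
      from avoid[OF s this a(1)] that show False by simp
    qed
    then show "\<exists>D\<le>settled n. halts_by n D" using s unfolding enters_def by blast
  qed (use jump_iff_halts_by in blast)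
  \<comment> \<open>The finitely many answers up to \<open>c\<close> are built into the
    algorithm.\<close>
  have "decidable X (\<lambda>n. if n \<le> c then n \<in> jump {} \<inter> {..c} else \<exists>D\<le>settled n. halts_by n D)"
    by (intro computable_intros decidable_finite decidable_halts_by computable_settled) auto
  moreover have "(if n \<le> c then n \<in> jump {} \<inter> {..c} else \<exists>D\<le>settled n. halts_by n D) \<longleftrightarrow> n \<in> jump {}" for n
    using halt[of n] by auto
  ultimately have "decidable X (\<lambda>n. n \<in> jump {})" by simp
  then show ?thesis unfolding turing_le_def X_def decidable_def computable_def .
qed

end
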